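(* Let $n\ge 1$, $s\in(0,1)$, and $a=1-2s\in(-1,1)$. There are constants $C>0$ and $C'>0$ depending only on $n$ and $s$ such that the following holds. Let $f:\mathbb R^n\to\mathbb R$ be a smooth bounded function and let $u:\mathbb R^n\times[0,\infty)\to\mathbb R$ be its extension, i.e. the bounded solution, continuous up to $y=0$ and given by the Poisson formula, of $$u(x,0)=f(x)\ \ (x\in\mathbb R^n),\qquad \Delta_x u+\frac{a}{y}u_y+u_{yy}=0\ \ (x\in\mathbb R^n,\ y>0).$$ Then for every $x\in\mathbb R^n$ the limits below exist and $$C\,(-\Delta)^s f(x)=-\lim_{y\to0^+}y^a u_y(x,y)=-(1-a)\lim_{y\to0^+}\frac{u(x,y)-u(x,0)}{y^{1-a}}.$$ Moreover, writing $u$ as a function of $(x,z)$ with $z=\left(\frac{y}{1-a}\right)^{1-a}$, the derivative $u_z(x,0)$ (from the right) exists and $$-u_z(x,0)=C'\,(-\Delta)^s f(x).$$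
   Context: The fractional Laplacian is $(-\Delta)^s f(x)=C_{n,s}\,\mathrm{PV}\int_{\mathbb R^n}\frac{f(x)-f(\xi)}{|x-\xi|^{n+2s}}\,d\xi$, where $C_{n,s}>0$ is the normalization constant for which $\widehat{(-\Delta)^s f}(\xi)=|\xi|^{2s}\hat f(\xi)$. The Poisson formula is $u(x,y)=\int_{\mathbb R^n}P(x-\xi,y)f(\xi)\,d\xi$ with $P(x,y)=C_{n,a}\,\frac{y^{1-a}}{(|x|^2+y^2)^{(n+1-a)/2}}$ for $y>0$, where $C_{n,a}>0$ is chosen so that $\int_{\mathbb R^n}P(x,y)\,dx=1$. Here $\Delta_x$ denotes the Laplacian in the variable $x\in\mathbb R^n$. *)

theory Defs
  imports "HOL-Analysis.Analysis"
begin

definition partial_deriv :: "'a::real_normed_vector \<Rightarrow> ('a \<Rightarrow> real) \<Rightarrow> 'a \<Rightarrow> real" where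
  "partial_deriv b f x = frechet_derivative f (at x) b"

fun iterated_partial :: "'a::real_normed_vector list \<Rightarrow> ('a \<Rightarrow> real) \<Rightarrow> 'a \<Rightarrow> real" where
  "iterated_partial [] f = f"
| "iterated_partial (b # bs) f = partial_deriv b (iterated_partial bs f)"

text \<open>Class \<open>C\<^sup>k\<close> on an open set. Differentiability of the derivatives of order below \<open>k\<close> is
  required explicitly because \<^const>\<open>frechet_derivative\<close> is unspecified where there is no derivative.\<close>

definition Ck_on :: "nat \<Rightarrow> ('a::euclidean_space \<Rightarrow> real) \<Rightarrow> 'a set \<Rightarrow> bool" where
  "Ck_on k f S \<longleftrightarrow>
     (\<forall>bs. set bs \<subseteq> Basis \<longrightarrow>
        (length bs < k \<longrightarrow> (\<forall>x\<in>S. iterated_partial bs f differentiable (at x))) \<and>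
        (length bs \<le> k \<longrightarrow> continuous_on S (iterated_partial bs f)))"

definition smooth_fun :: "('a::euclidean_space \<Rightarrow> real) \<Rightarrow> bool" where
  "smooth_fun f \<longleftrightarrow> (\<forall>k. Ck_on k f UNIV)"

definition laplacian :: "('a::euclidean_space \<Rightarrow> real) \<Rightarrow> 'a \<Rightarrow> real" where
  "laplacian f x = (\<Sum>b\<in>Basis. iterated_partial [b, b] f x)"

definition schwartz_fun :: "('a::euclidean_space \<Rightarrow> real) \<Rightarrow> bool" where
  "schwartz_fun f \<longleftrightarrow> smooth_fun f \<and>
     (\<forall>m bs. set bs \<subseteq> Basis \<longrightarrow> bounded (range (\<lambda>x. norm x ^ m * iterated_partial bs f x)))"

text \<open>With this normalisation of the Fourier transform the symbol of \<open>-\<Delta>\<close> is exactly \<open>|\<xi>|\<^sup>2\<close>.\<close>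

definition fourier_transform :: "('a::euclidean_space \<Rightarrow> real) \<Rightarrow> 'a \<Rightarrow> complex" where
  "fourier_transform f \<xi> = (LINT x|lborel. cis (- (x \<bullet> \<xi>)) * complex_of_real (f x))"

definition pv_frac_integral :: "real \<Rightarrow> (real ^ 'n \<Rightarrow> real) \<Rightarrow> real ^ 'n \<Rightarrow> real" where
  "pv_frac_integral s f x =
     Lim (at_right 0) (\<lambda>\<epsilon>. LINT \<xi>:{\<xi>. norm (x - \<xi>) > \<epsilon>}|lborel.
        (f x - f \<xi>) / norm (x - \<xi>) powr (real CARD('n) + 2 * s))"

text \<open>The Fourier identity is imposed on Schwartz functions; since
  \<^const>\<open>pv_frac_integral\<close> does not involve the constant, at most one value can satisfy it.\<close>

definition frac_laplacian_const :: "'n::finite itself \<Rightarrow> real \<Rightarrow> real" where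
  "frac_laplacian_const _ s = (SOME c. c > 0 \<and>
     (\<forall>(f :: real ^ 'n \<Rightarrow> real) \<xi>. schwartz_fun f \<longrightarrow>
        fourier_transform (\<lambda>x. c * pv_frac_integral s f x) \<xi>
          = complex_of_real (norm \<xi> powr (2 * s)) * fourier_transform f \<xi>))"

definition frac_laplacian :: "real \<Rightarrow> (real ^ 'n \<Rightarrow> real) \<Rightarrow> real ^ 'n \<Rightarrow> real" where
  "frac_laplacian s f x = frac_laplacian_const TYPE('n) s * pv_frac_integral s f x"

definition poisson_profile :: "real \<Rightarrow> real ^ 'n \<Rightarrow> real \<Rightarrow> real" where
  "poisson_profile a x y =
     y powr (1 - a) / ((norm x)\<^sup>2 + y\<^sup>2) powr ((real CARD('n) + 1 - a) / 2)"

definition poisson_const :: "'n::finite itself \<Rightarrow> real \<Rightarrow> real" where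
  "poisson_const _ a = (THE c. c > 0 \<and>
     (\<forall>y>0. (LINT x|lborel. c * poisson_profile a (x :: real ^ 'n) y) = 1))"

definition poisson_kernel :: "real \<Rightarrow> real ^ 'n \<Rightarrow> real \<Rightarrow> real" where
  "poisson_kernel a x y = poisson_const TYPE('n) a * poisson_profile a x y"

text \<open>The values of \<open>u x y\<close> for \<open>y < 0\<close> are irrelevant.\<close>

definition is_extension ::
    "real \<Rightarrow> (real ^ 'n \<Rightarrow> real) \<Rightarrow> (real ^ 'n \<Rightarrow> real \<Rightarrow> real) \<Rightarrow> bool" where
  "is_extension a f u \<longleftrightarrow>
     bounded ((\<lambda>(x, y). u x y) ` (UNIV \<times> {0..})) \<and>
     continuous_on (UNIV \<times> {0..}) (\<lambda>(x, y). u x y) \<and>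
     (\<forall>x. u x 0 = f x) \<and>
     (\<forall>x. \<forall>y>0. u x y = (LINT \<xi>|lborel. poisson_kernel a (x - \<xi>) y * f \<xi>)) \<and>
     Ck_on 2 (\<lambda>(x, y). u x y) (UNIV \<times> {0<..}) \<and>
     (\<forall>x. \<forall>y>0. laplacian (\<lambda>x'. u x' y) x + a / y * deriv (u x) y + deriv (deriv (u x)) y = 0)"

end

(* Symmetrising h and -h turns the Poisson extension into
     u(x,y) - f(x) = -(c/2) y^(1-a) int d(h) (|h|^2 + y^2)^(-(n+2s)/2) dh,  d(h) = 2 f(x) - f(x+h) - f(x-h),
   and the same symmetrisation makes the principal value the absolutely convergent integral
   1/2 int d(h) |h|^(-(n+2s)) dh, because |d(h)| <= K min(1, |h|^2). Both limits y -> 0 are then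
   dominated convergence; in y^a u_y the term coming from the derivative of the kernel vanishes.
   The constants are positive only if the Fourier normalisation in frac_laplacian_const can be met by
   some c > 0 (otherwise SOME would be arbitrary). For Schwartz f, Fubini gives the multiplier
   int (1 - cos(h . xi)) |h|^(-(n+2s)) dh, which is a positive multiple of |xi|^(2s) by scaling and by
   rotation invariance of Lebesgue measure. *)

theory Submission
  imports Defs
begin

subsection \<open>Radial integrals and invariance of Lebesgue measure\<close>

text \<open>The identity n + 1 - a = n + 2s makes the two sides comparable: both integrate the same
  second difference, and the Poisson kernel degenerates at y = 0 to the kernel of the fractional
  Laplacian. The common exponent q lies strictly between n and n + 2. The upper limit makes |h|^2
  |h|^(-q) integrable at the origin, the lower one makes |h|^(-q) integrable at infinity, and every
  domination rests on this window. A first difference is only O(|h|), which does not suffice for s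
  \<ge> 1/2; hence the symmetrisation, which in the principal value has to take place before the
  cut-off is removed. For the Fourier multiplier a bound on the second difference at a fixed x is
  not enough: Fubini asks for its L1 norm in x to be O(min(1, |h|^2)), which comes from decay of the
  second derivatives that is uniform over unit balls. With c the Poisson constant and d the constant
  of the fractional Laplacian, the results are C = (1-a) c/d and C' = (1-a)^(1-a) c/d.\<close>

text \<open>Half-lines determine a measure on the reals, and there the claim is the volume V r^n of
  a ball against the integral of its derivative n V r^(n-1), the area of the sphere of radius
  r.\<close>

lemma distr_norm_lborel:
  "distr (lborel :: 'a::euclidean_space measure) borel norm =
     density lborel (\<lambda>r. ennreal (DIM('a) * unit_ball_vol DIM('a) * r ^ (DIM('a) - 1)) * indicator {0..} r)"
  (is "?M = density lborel ?d")
proof (rule measure_eqI_generator_eq[where E = "range atMost" and \<Omega> = UNIV and A = "\<lambda>i. {..real i}"])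
  let ?V = "unit_ball_vol DIM('a)"
  have ball: "emeasure ?M {..r} = ennreal (if r < 0 then 0 else ?V * r ^ DIM('a))" for r :: real
  proof -
    have "emeasure ?M {..r} = emeasure lborel (norm -` {..r} :: 'a set)"
      by (subst emeasure_distr) auto
    also have "(norm -` {..r} :: 'a set) = cball 0 r" by auto
    finally show ?thesis by (auto simp: emeasure_cball)
  qed
  have dens: "emeasure (density lborel ?d) {..r} = ennreal (if r < 0 then 0 else ?V * r ^ DIM('a))" for r :: real
  proof (cases "r < 0")
    case True
    have "emeasure (density lborel ?d) {..r} = (\<integral>\<^sup>+x. ?d x * indicator {..r} x \<partial>lborel)"
      by (rule emeasure_density) auto
    also have "\<dots> = (\<integral>\<^sup>+x. 0 \<partial>(lborel :: real measure))"
      using True by (intro nn_integral_cong) (auto split: split_indicator)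
    finally show ?thesis using True by simp
  next
    case False
    have "emeasure (density lborel ?d) {..r} = (\<integral>\<^sup>+x. ?d x * indicator {..r} x \<partial>lborel)"
      by (rule emeasure_density) auto
    also have "\<dots> = (\<integral>\<^sup>+x. ennreal (DIM('a) * ?V * x ^ (DIM('a) - 1)) * indicator {0..r} x \<partial>lborel)"
      by (intro nn_integral_cong) (auto split: split_indicator)
    also have "\<dots> = ennreal (?V * r ^ DIM('a) - ?V * 0 ^ DIM('a))"
      using False by (intro nn_integral_FTC_Icc) (auto intro!: derivative_eq_intros)
    finally show ?thesis using False by simp
  qed
  show "emeasure ?M X = emeasure (density lborel ?d) X" if "X \<in> range atMost" for X
    using that ball dens by auto
  show "emeasure ?M {..real i} \<noteq> \<infinity>" for i
    unfolding ball by simp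
  show "Int_stable (range (atMost :: real \<Rightarrow> _))"
    by (auto simp: Int_stable_def)
  show "(\<Union>i. {..real i}) = UNIV"
    by (auto intro: real_arch_simple)
qed (auto simp: borel_eq_atMost)

lemma nn_integral_radial:
  assumes [measurable]: "g \<in> borel_measurable borel"
  shows "(\<integral>\<^sup>+x. g (norm x) \<partial>(lborel :: 'a::euclidean_space measure)) =
    (\<integral>\<^sup>+r. ennreal (DIM('a) * unit_ball_vol DIM('a) * r ^ (DIM('a) - 1)) * indicator {0..} r * g r \<partial>lborel)"
proof -
  have "(\<integral>\<^sup>+x. g (norm x) \<partial>(lborel :: 'a measure)) = (\<integral>\<^sup>+r. g r \<partial>distr (lborel :: 'a measure) borel norm)"
    by (rule nn_integral_distr[symmetric]) auto
  then show ?thesis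
    unfolding distr_norm_lborel by (simp add: nn_integral_density)
qed

text \<open>In polar coordinates the integrand is r^(n+1-p) near 0 and r^(n-1-p) near infinity; the
  two hypotheses on \<open>p\<close> are the conditions for these powers to be integrable there. For
  p = n + 2s they read 0 < s < 1.\<close>

lemma integrable_min_norm_powr:
  fixes p :: real
  assumes p: "real DIM('a) < p" "p < real DIM('a) + 2"
  shows "integrable lborel (\<lambda>h::'a::euclidean_space. min 1 ((norm h)\<^sup>2) * norm h powr (-p))"
proof (rule integrableI_nonneg)
  let ?V = "unit_ball_vol DIM('a)" and ?n = "real DIM('a)"
  let ?g = "\<lambda>r::real. min 1 (r\<^sup>2) * r powr (-p)"
  have "(\<integral>\<^sup>+h. ennreal (?g (norm h)) \<partial>(lborel :: 'a measure)) =
    (\<integral>\<^sup>+r. ennreal (?n * ?V * r ^ (DIM('a) - 1)) * indicator {0..} r * ennreal (?g r) \<partial>lborel)"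
    by (rule nn_integral_radial) simp
  \<comment> \<open>The two indicators overlap at r = 1, which only enlarges the bound; finiteness
    is the goal.\<close>
  also have "\<dots> \<le> (\<integral>\<^sup>+r. ennreal (?n * ?V) * (ennreal (indicator {0..1} r * r powr (?n + 1 - p))
        + ennreal (indicator {1..} r * r powr (?n - 1 - p))) \<partial>lborel)"
  proof (intro nn_integral_mono)
    fix r :: real
    have pw: "r ^ (DIM('a) - 1) = r powr (?n - 1)" if "r > 0"
      using that by (simp add: powr_realpow[symmetric] of_nat_diff)
    have e: "ennreal (?n * ?V * r ^ (DIM('a) - 1)) * ennreal (?g r)
       \<le> ennreal (?n * ?V) * ennreal (indicator {0..1} r * r powr (?n + 1 - p) + indicator {1..} r * r powr (?n - 1 - p))"
      if r: "r > 0"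
    proof -
      have "r ^ (DIM('a) - 1) * ?g r \<le> indicator {0..1} r * r powr (?n + 1 - p) + indicator {1..} r * r powr (?n - 1 - p)"
      proof (cases "r \<le> 1")
        case True
        then have "min 1 (r\<^sup>2) = r powr 2" using r by (simp add: abs_square_le_1 powr_numeral)
        then have "r ^ (DIM('a) - 1) * ?g r = r powr (?n - 1 + (2 + - p))"
          unfolding pw[OF r] powr_add by simp
        also have "?n - 1 + (2 + - p) = ?n + 1 - p" by simp
        finally show ?thesis using True r by (simp split: split_indicator)
      next
        case False
        then have "min 1 (r\<^sup>2) = 1" using r by (simp add: min_def abs_square_le_1)
        then have "r ^ (DIM('a) - 1) * ?g r = r powr (?n - 1 + - p)"
          unfolding pw[OF r] powr_add by simp
        also have "?n - 1 + - p = ?n - 1 - p" by simp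
        finally show ?thesis using False r by (simp split: split_indicator)
      qed
      then have "?n * ?V * (r ^ (DIM('a) - 1) * ?g r) \<le> ?n * ?V * (indicator {0..1} r * r powr (?n + 1 - p) + indicator {1..} r * r powr (?n - 1 - p))"
        by (intro mult_left_mono) auto
      then show ?thesis
        using r by (subst (1 2) ennreal_mult[symmetric]) (auto simp: mult.assoc intro!: ennreal_leI)
    qed
    show "ennreal (?n * ?V * r ^ (DIM('a) - 1)) * indicator {0..} r * ennreal (?g r) \<le>
      ennreal (?n * ?V) * (ennreal (indicator {0..1} r * r powr (?n + 1 - p))
        + ennreal (indicator {1..} r * r powr (?n - 1 - p)))"
      using e by (cases "r > 0"; cases "r = 0") (auto simp: ennreal_plus[symmetric] simp del: ennreal_plus)
  qed
  also have "\<dots> = ennreal (?n * ?V) * ((\<integral>\<^sup>+r. ennreal (indicator {0..1} r * r powr (?n + 1 - p)) \<partial>lborel)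
     + (\<integral>\<^sup>+r. ennreal (indicator {1..} r * r powr (?n - 1 - p)) \<partial>lborel))"
    by (subst nn_integral_cmult, simp, subst nn_integral_add) auto
  also have "(\<integral>\<^sup>+r. ennreal (indicator {0..1} r * r powr (?n + 1 - p)) \<partial>lborel) = ennreal (1 powr (?n + 1 - p + 1) / (?n + 1 - p + 1))"
    using p by (intro nn_integral_has_integral_lebesgue has_integral_powr_from_0) auto
  also have "(\<integral>\<^sup>+r. ennreal (indicator {1..} r * r powr (?n - 1 - p)) \<partial>lborel) = ennreal (- (1 powr (?n - 1 - p + 1)) / (?n - 1 - p + 1))"
    using p by (intro nn_integral_has_integral_lebesgue has_integral_powr_to_inf) auto
  also have "ennreal (?n * ?V) * (ennreal (1 powr (?n + 1 - p + 1) / (?n + 1 - p + 1)) + ennreal (- (1 powr (?n - 1 - p + 1)) / (?n - 1 - p + 1))) < \<infinity>"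
    by (simp add: ennreal_mult_less_top)
  finally show "(\<integral>\<^sup>+h. ennreal (?g (norm h)) \<partial>(lborel :: 'a measure)) < \<infinity>" .
qed auto

section \<open>Affine and orthogonal changes of variables\<close>

lemma nn_integral_lborel_affine:
  fixes t :: "'a::euclidean_space"
  assumes [measurable]: "f \<in> borel_measurable borel" and c: "c \<noteq> 0"
  shows "(\<integral>\<^sup>+x. f x \<partial>lborel) = ennreal (\<bar>c\<bar> ^ DIM('a)) * (\<integral>\<^sup>+x. f (t + c *\<^sub>R x) \<partial>lborel)"
  by (subst lborel_affine[OF c, of t])
     (simp add: nn_integral_density nn_integral_distr nn_integral_cmult)

lemma integrable_lborel_affine:
  fixes t :: "'a::euclidean_space" and f :: "'a \<Rightarrow> 'b :: {banach, second_countable_topology}"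
  assumes f: "integrable lborel f" and c: "c \<noteq> 0"
  shows "integrable lborel (\<lambda>x. f (t + c *\<^sub>R x))"
proof -
  have [measurable]: "f \<in> borel_measurable borel"
    using borel_measurable_integrable[OF f] by simp
  show ?thesis
    using f c unfolding integrable_iff_bounded
    by (subst (asm) nn_integral_lborel_affine[where c=c and t=t]) (auto simp: ennreal_mult_less_top)
qed

lemma integrable_lborel_affine_iff:
  fixes t :: "'a::euclidean_space" and f :: "'a \<Rightarrow> 'b :: {banach, second_countable_topology}"
  assumes c: "c \<noteq> 0"
  shows "integrable lborel (\<lambda>x. f (t + c *\<^sub>R x)) \<longleftrightarrow> integrable lborel f"
  using integrable_lborel_affine[of f c t] c
    integrable_lborel_affine[of "\<lambda>x. f (t + c *\<^sub>R x)" "1/c" "(-1/c) *\<^sub>R t"]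
  by (auto simp: algebra_simps)

lemma integral_lborel_affine:
  fixes t :: "'a::euclidean_space" and f :: "'a \<Rightarrow> 'b :: {banach, second_countable_topology}"
  assumes c: "c \<noteq> 0"
  shows "(\<integral>x. f x \<partial>lborel) = \<bar>c\<bar> ^ DIM('a) *\<^sub>R (\<integral>x. f (t + c *\<^sub>R x) \<partial>lborel)"
proof (cases "integrable lborel f")
  case True
  then have [measurable]: "f \<in> borel_measurable borel"
    using borel_measurable_integrable by force
  show ?thesis using True c integrable_lborel_affine[OF True c, of t]
    by (subst lborel_affine[OF c, of t]) (simp add: integral_density integral_distr)
next
  case False
  then show ?thesis using c by (simp add: integrable_lborel_affine_iff not_integrable_integral_eq)
qed

lemma nn_integral_lborel_translation:
  fixes t :: "'a::euclidean_space"
  assumes "f \<in> borel_measurable borel"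
  shows "(\<integral>\<^sup>+x. f (t + x) \<partial>lborel) = (\<integral>\<^sup>+x. f x \<partial>lborel)"
  using nn_integral_lborel_affine[OF assms, of 1 t] by simp

lemma nn_integral_lborel_reflection:
  fixes t :: "'a::euclidean_space"
  assumes "f \<in> borel_measurable borel"
  shows "(\<integral>\<^sup>+x. f (t - x) \<partial>lborel) = (\<integral>\<^sup>+x. f x \<partial>lborel)"
  using nn_integral_lborel_affine[OF assms, of "-1" t] by simp

lemma nn_integral_lborel_orthogonal:
  fixes T :: "'a::euclidean_space \<Rightarrow> 'a"
  assumes T: "orthogonal_transformation T" and g[measurable]: "g \<in> borel_measurable borel"
  shows "(\<integral>\<^sup>+x. g (T x) \<partial>lborel) = (\<integral>\<^sup>+x. g x \<partial>lborel)"
proof -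
  have lin: "linear T" and nT: "norm (T x) = norm x" for x
    using T by (auto simp: orthogonal_transformation)
  have [measurable]: "T \<in> borel_measurable borel"
    using lin by (intro borel_measurable_continuous_onI linear_continuous_on linear_conv_bounded_linear[THEN iffD1])
  from orthogonal_transformation_surj[OF T] have surj: "\<exists>x. T x = y" for y by (metis surjD)
  \<comment> \<open>The image measure of \<open>T\<close> is translation invariant; integrating \<open>g (T x) * k (T x + y)\<close> in both
    orders shows that it is a multiple of Lebesgue measure, and the unit ball fixes the factor.\<close>
  define k where "k = (indicator (ball 0 1) :: 'a \<Rightarrow> ennreal)"
  have [measurable]: "k \<in> borel_measurable borel"
    unfolding k_def by (intro borel_measurable_indicator borel_open) simp
  have trans: "(\<integral>\<^sup>+x. h (T x + y) \<partial>lborel) = (\<integral>\<^sup>+x. h (T x) \<partial>lborel)"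
    if [measurable]: "h \<in> borel_measurable borel" for h :: "'a \<Rightarrow> ennreal" and y
  proof -
    obtain z where z: "T z = y" using surj by blast
    have "(\<integral>\<^sup>+x. h (T x + y) \<partial>lborel) = (\<integral>\<^sup>+x. h (T (z + x)) \<partial>lborel)"
      by (simp add: z[symmetric] linear_add[OF lin] add.commute)
    also have "\<dots> = (\<integral>\<^sup>+x. h (T x) \<partial>lborel)"
      by (rule nn_integral_lborel_translation[where f="\<lambda>x. h (T x)"]) simp
    finally show ?thesis .
  qed
  have V: "(\<integral>\<^sup>+y. k y \<partial>lborel) = ennreal (unit_ball_vol DIM('a))"
    by (simp add: k_def emeasure_ball)
  have kshift: "(\<integral>\<^sup>+y. g (T x) * k (T x + y) \<partial>lborel) = g (T x) * (\<integral>\<^sup>+y. k y \<partial>lborel)" for x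
  proof -
    have "(\<integral>\<^sup>+y. g (T x) * k (T x + y) \<partial>lborel) = g (T x) * (\<integral>\<^sup>+y. k (T x + y) \<partial>lborel)"
      by (rule nn_integral_cmult) measurable
    then show ?thesis by (subst (asm) nn_integral_lborel_translation) simp_all
  qed
  have kT: "k (T x) = k x" for x by (auto simp: k_def nT split: split_indicator)
  have "(\<integral>\<^sup>+x. g (T x) \<partial>lborel) * ennreal (unit_ball_vol DIM('a))
      = (\<integral>\<^sup>+x. g (T x) * (\<integral>\<^sup>+y. k y \<partial>lborel) \<partial>lborel)"
    by (simp add: nn_integral_multc V)
  also have "\<dots> = (\<integral>\<^sup>+x. (\<integral>\<^sup>+y. g (T x) * k (T x + y) \<partial>lborel) \<partial>lborel)"
    unfolding kshift ..
  also have "\<dots> = (\<integral>\<^sup>+y. (\<integral>\<^sup>+x. g (T x) * k (T x + y) \<partial>lborel) \<partial>lborel)"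
    by (rule lborel_pair.Fubini') measurable
  \<comment> \<open>A shift by \<open>- y\<close> moves the parameter from \<open>k\<close> to
    \<open>g\<close>. After a second exchange of the integrals the inner one over \<open>y\<close>
    is a reflection of the integral of \<open>g\<close>, and \<open>k (T x)\<close> factors
    out.\<close>
  also have "\<dots> = (\<integral>\<^sup>+y. (\<integral>\<^sup>+x. g (T x + - y) * k (T x + -y + y) \<partial>lborel) \<partial>lborel)"
    by (subst trans) auto
  also have "\<dots> = (\<integral>\<^sup>+x. (\<integral>\<^sup>+y. g (T x - y) * k (T x) \<partial>lborel) \<partial>lborel)"
    by (subst lborel_pair.Fubini'[where f="\<lambda>x y. g (T x + - y) * k (T x + - y + y)"], measurable)
  also have "\<dots> = (\<integral>\<^sup>+x. (\<integral>\<^sup>+y. g y \<partial>lborel) * k (T x) \<partial>lborel)"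
    by (simp add: nn_integral_multc nn_integral_lborel_reflection)
  also have "\<dots> = (\<integral>\<^sup>+y. g y \<partial>lborel) * ennreal (unit_ball_vol DIM('a))"
    unfolding kT by (subst nn_integral_cmult) (simp_all add: V emeasure_ball)
  finally show ?thesis
    using unit_ball_vol_pos[of "DIM('a)"]
    by (auto simp: mult.commute[of _ "ennreal (unit_ball_vol _)"] ennreal_mult_cancel_left
      simp del: unit_ball_vol_pos)
qed

subsection \<open>The Fourier multiplier\<close>

lemma one_minus_cos_bounds:
  fixes t :: real
  shows "1 - cos t \<le> t\<^sup>2 / 2" "0 \<le> 1 - cos t" "1 - cos t \<le> 2"
proof -
  have "1 - cos t = 2 * (sin (t / 2))\<^sup>2"
    using cos_double_sin[of "t / 2"] by simp
  also have "\<bar>sin (t / 2)\<bar>\<^sup>2 \<le> \<bar>t / 2\<bar>\<^sup>2"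
    by (intro power_mono abs_sin_x_le_abs_x) auto
  then have "2 * (sin (t / 2))\<^sup>2 \<le> t\<^sup>2 / 2" by (simp add: power2_eq_square)
  finally show "1 - cos t \<le> t\<^sup>2 / 2" .
  show "0 \<le> 1 - cos t" "1 - cos t \<le> 2" using cos_le_one[of t] cos_ge_minus_one[of t] by linarith+
qed

text \<open>Domination criterion for the integrals in h: the quadratic bound pays for the
  singularity at the origin, the constant bound for the behaviour at infinity.\<close>

lemma integrable_min_norm_bound:
  fixes g :: "'a::euclidean_space \<Rightarrow> real"
  assumes p: "real DIM('a) < p" "p < real DIM('a) + 2"
    and [measurable]: "g \<in> borel_measurable borel"
    and g: "\<And>h. \<bar>g h\<bar> \<le> K * min 1 ((norm h)\<^sup>2)"
  shows "integrable lborel (\<lambda>h. g h * norm h powr (-p))"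
proof (rule Bochner_Integration.integrable_bound)
  show "integrable lborel (\<lambda>h::'a. K * (min 1 ((norm h)\<^sup>2) * norm h powr (-p)))"
    using integrable_min_norm_powr[OF p] by (rule integrable_mult_right)
  show "AE h in lborel. norm (g h * norm h powr (-p)) \<le> norm (K * (min 1 ((norm h)\<^sup>2) * norm h powr (-p)))"
  proof (intro AE_I2)
    fix h :: 'a
    have "\<bar>g h\<bar> * norm h powr (-p) \<le> K * min 1 ((norm h)\<^sup>2) * norm h powr (-p)"
      using g by (rule mult_right_mono) simp
    also have "\<dots> \<le> norm (K * (min 1 ((norm h)\<^sup>2) * norm h powr (-p)))"
      by (simp add: mult.assoc del: real_norm_def) (simp add: abs_mult mult_right_mono)
    finally show "norm (g h * norm h powr (-p)) \<le> norm (K * (min 1 ((norm h)\<^sup>2) * norm h powr (-p)))"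
      by (simp add: abs_mult)
  qed
qed simp

lemma integrable_one_minus_cos_norm_powr:
  fixes \<xi> :: "'a::euclidean_space"
  assumes p: "real DIM('a) < p" "p < real DIM('a) + 2"
  shows "integrable lborel (\<lambda>h. (1 - cos (h \<bullet> \<xi>)) * norm h powr (-p))"
proof (rule integrable_min_norm_bound[OF p])
  fix h :: 'a
  let ?t = "h \<bullet> \<xi>"
  have "?t\<^sup>2 \<le> (norm h * norm \<xi>)\<^sup>2"
    using Cauchy_Schwarz_ineq2[of h \<xi>] by (metis abs_ge_zero power2_abs power_mono)
  then have a: "?t\<^sup>2 \<le> (norm h)\<^sup>2 * (norm \<xi>)\<^sup>2" by (simp add: power_mult_distrib)
  \<comment> \<open>One constant serves both regimes: 2 bounds the integrand far out, and |xi|^2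
    controls t^2/2 near the origin.\<close>
  have b: "1 - cos ?t \<le> (2 + (norm \<xi>)\<^sup>2) * (norm h)\<^sup>2"
    using one_minus_cos_bounds(1)[of ?t] a by (simp add: algebra_simps) (smt (verit) zero_le_power2)
  show "\<bar>1 - cos ?t\<bar> \<le> (2 + (norm \<xi>)\<^sup>2) * min 1 ((norm h)\<^sup>2)"
  proof (cases "1 \<le> (norm h)\<^sup>2")
    case True
    moreover have "1 - cos ?t \<le> 2 + (norm \<xi>)\<^sup>2"
      using one_minus_cos_bounds(3)[of ?t] zero_le_power2[of "norm \<xi>"] by linarith
    ultimately show ?thesis using one_minus_cos_bounds(2)[of ?t] by (simp add: min_absorb1)
  next
    case False
    then show ?thesis using one_minus_cos_bounds(2)[of ?t] b by (simp add: min_absorb2)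
  qed
qed simp

lemma ex_symbol_const:
  fixes p :: real
  assumes p: "real CARD('n::finite) < p" "p < real CARD('n) + 2"
  shows "\<exists>c>0. \<forall>\<xi>::real^'n. (LINT h|lborel. (1 - cos (h \<bullet> \<xi>)) * norm h powr (-p)) = c * norm \<xi> powr (p - CARD('n))"
proof -
  define S where "S \<xi> = (LINT h|lborel. (1 - cos (h \<bullet> \<xi>)) * norm h powr (-p))" for \<xi> :: "real^'n"
  have int: "integrable lborel (\<lambda>h. (1 - cos (h \<bullet> \<xi>)) * norm h powr (-p))" for \<xi> :: "real^'n"
    using p by (intro integrable_one_minus_cos_norm_powr) auto
  have nn: "0 \<le> (1 - cos (h \<bullet> \<xi>)) * norm h powr (-p)" for h \<xi> :: "real^'n"
    by (intro mult_nonneg_nonneg one_minus_cos_bounds) auto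
  \<comment> \<open>The integrand is nonnegative, so rotation invariance of nonnegative integrals
    carries over to \<open>S\<close>.\<close>
  have S_nn: "S \<xi> = enn2real (\<integral>\<^sup>+h. ennreal ((1 - cos (h \<bullet> \<xi>)) * norm h powr (-p)) \<partial>lborel)" for \<xi> :: "real^'n"
    unfolding S_def using nn by (intro integral_eq_nn_integral) auto
  have rot: "S \<xi> = S \<eta>" if norms: "norm \<xi> = norm \<eta>" for \<xi> \<eta> :: "real^'n"
  proof -
    from orthogonal_transformation_exists[OF norms[symmetric]]
    obtain T where T: "orthogonal_transformation T" "T \<eta> = \<xi>" by blast
    have "(T h \<bullet> \<xi>) = h \<bullet> \<eta>" "norm (T h) = norm h" for h
      using T orthogonal_transformation_norm[OF T(1)] by (auto simp: orthogonal_transformation_def)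
    then show ?thesis
      unfolding S_nn
      using nn_integral_lborel_orthogonal[OF T(1), of "\<lambda>h. ennreal ((1 - cos (h \<bullet> \<xi>)) * norm h powr (-p))"]
      by simp
  qed
  have scale: "S (t *\<^sub>R \<xi>) = t powr (p - CARD('n)) * S \<xi>" if t: "t > 0" for t and \<xi> :: "real^'n"
  proof -
    have "S \<xi> = t ^ CARD('n) * (LINT h|lborel. (1 - cos ((t *\<^sub>R h) \<bullet> \<xi>)) * norm (t *\<^sub>R h) powr (-p))"
      unfolding S_def
      using integral_lborel_affine[of t "\<lambda>h. (1 - cos (h \<bullet> \<xi>)) * norm h powr (-p)" 0] t by simp
    also have "(LINT h|lborel. (1 - cos ((t *\<^sub>R h) \<bullet> \<xi>)) * norm (t *\<^sub>R h) powr (-p))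
       = (LINT h|lborel. t powr (-p) * ((1 - cos (h \<bullet> (t *\<^sub>R \<xi>))) * norm h powr (-p)))"
      using t by (intro Bochner_Integration.integral_cong) (auto simp: powr_mult)
    also have "\<dots> = t powr (-p) * S (t *\<^sub>R \<xi>)"
      by (simp add: S_def)
    finally have "S \<xi> = t powr (CARD('n) - p) * S (t *\<^sub>R \<xi>)"
      using t by (simp add: powr_realpow[symmetric] powr_diff powr_minus field_simps)
    then show ?thesis using t by (simp add: powr_diff field_simps)
  qed
  obtain e :: "real^'n" where e: "norm e = 1" using norm_axis_1 by blast
  \<comment> \<open>The constant is the value of \<open>S\<close> at a unit vector. At xi = 0 both
    sides vanish, since \<open>0 powr r\<close> is 0.\<close>
  have S: "S \<xi> = S e * norm \<xi> powr (p - CARD('n))" for \<xi>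
  proof (cases "\<xi> = 0")
    case True
    then show ?thesis by (simp add: S_def)
  next
    case False
    have "S (norm \<xi> *\<^sub>R e) = norm \<xi> powr (p - CARD('n)) * S e"
      using False by (intro scale) auto
    moreover have "S (norm \<xi> *\<^sub>R e) = S \<xi>" by (rule rot) (simp add: e)
    ultimately show ?thesis by simp
  qed
  \<comment> \<open>A zero integral would force the nonnegative integrand to vanish almost
    everywhere, yet on the ball of radius 1/2 around e/2 one has 0 < h . e < 1 < pi and thus cos (h
    . e) < 1.\<close>
  have "S e \<noteq> 0"
  proof
    assume "S e = 0"
    then have "AE h in lborel. (1 - cos (h \<bullet> e)) * norm h powr (-p) = 0"
      unfolding S_def using int nn by (subst (asm) integral_nonneg_eq_0_iff_AE) auto
    then have "AE h in lborel. h \<notin> ball ((1/2) *\<^sub>R e) (1/2)"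
    proof eventually_elim
      case (elim h)
      show ?case
      proof
        assume "h \<in> ball ((1/2) *\<^sub>R e) (1/2)"
        then have d: "norm ((1/2) *\<^sub>R e - h) < 1/2" by (simp add: dist_norm)
        have "\<bar>((1/2) *\<^sub>R e - h) \<bullet> e\<bar> < 1/2"
          using Cauchy_Schwarz_ineq2[of "(1/2) *\<^sub>R e - h" e] d e by simp
        moreover have "e \<bullet> e = 1" using e by (simp add: dot_square_norm)
        ultimately have he: "0 < h \<bullet> e" "h \<bullet> e < 1" by (auto simp: inner_diff_left abs_if split: if_splits)
        then have "h \<noteq> 0" by auto
        moreover have "cos (h \<bullet> e) < 1" using cos_monotone_0_pi[of 0 "h \<bullet> e"] he pi_gt3 by simp
        ultimately show False using elim by simp
      qed
    qed
    then have "emeasure lborel (ball ((1/2) *\<^sub>R e) (1/2)) = 0"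
      by (subst (asm) AE_iff_measurable[OF _ refl]) (auto simp: ball_def)
    then show False using unit_ball_vol_pos[of "real CARD('n)"]
      by (simp add: emeasure_ball del: unit_ball_vol_pos)
  qed
  moreover have "S e \<ge> 0" unfolding S_def using nn by (intro Bochner_Integration.integral_nonneg)
  ultimately have "S e > 0" by simp
  moreover have "\<forall>\<xi>. S \<xi> = S e * norm \<xi> powr (p - CARD('n))" using S by blast
  ultimately have "\<exists>c>0. \<forall>\<xi>. S \<xi> = c * norm \<xi> powr (p - CARD('n))" by blast
  then show ?thesis unfolding S_def .
qed

section \<open>Dominated convergence with a continuous parameter\<close>

text \<open>By first countability, sequences decide the limit, and along each of them dominated
  convergence applies. The bound is asked for on \<open>S - {y0}\<close> only, so the lemma covers
  both the limits y -> 0+ and difference quotients, which are not controlled at the base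
  point.\<close>

lemma integral_tendsto_at_within:
  fixes s :: "'b::first_countable_topology \<Rightarrow> 'a \<Rightarrow> real"
  assumes "integrable M w" and "f \<in> borel_measurable M"
    and "\<And>y. y \<in> S - {y0} \<Longrightarrow> s y \<in> borel_measurable M"
    and bound: "\<And>x y. y \<in> S - {y0} \<Longrightarrow> \<bar>s y x\<bar> \<le> w x"
    and lim: "\<And>x. ((\<lambda>y. s y x) \<longlongrightarrow> f x) (at y0 within S)"
  shows "((\<lambda>y. integral\<^sup>L M (s y)) \<longlongrightarrow> integral\<^sup>L M f) (at y0 within S)"
  unfolding tendsto_at_iff_sequentially
proof (intro allI impI)
  fix X assume X: "\<forall>i. X i \<in> S - {y0}" "X \<longlonglongrightarrow> y0"
  have "(\<lambda>i. s (X i) x) \<longlonglongrightarrow> f x" for x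
    using lim[of x] X unfolding tendsto_at_iff_sequentially by (auto simp: o_def)
  then show "((\<lambda>y. integral\<^sup>L M (s y)) \<circ> X) \<longlonglongrightarrow> integral\<^sup>L M f"
    unfolding o_def using X assms by (intro integral_dominated_convergence[where w=w]) auto
qed

subsection \<open>Second differences and the principal value\<close>

text \<open>The sum of \<open>f x - f (x + h)\<close> and its mirror image: the first-order Taylor
  terms cancel, and the sign is that of minus the Laplacian.\<close>

definition second_difference :: "('a::real_vector \<Rightarrow> real) \<Rightarrow> 'a \<Rightarrow> 'a \<Rightarrow> real" where
  "second_difference f x h = 2 * f x - f (x + h) - f (x - h)"

lemma line_mean_value:
  fixes g :: "'a::real_normed_vector \<Rightarrow> real"
  assumes g: "\<And>z. (g has_derivative g' z) (at z)"
  obtains \<theta> where "0 < \<theta>" "\<theta> < 1" "g (y + h) - g y = g' (y + \<theta> *\<^sub>R h) h"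
proof -
  have "((\<lambda>t. g (y + t *\<^sub>R h)) has_derivative (\<lambda>r. g' (y + t *\<^sub>R h) (r *\<^sub>R h))) (at t within {0..1})" for t
    by (rule has_derivative_at_withinI, rule has_derivative_compose[OF _ g, of "\<lambda>t. y + t *\<^sub>R h"])
       (auto intro!: derivative_eq_intros)
  then obtain \<theta> where "\<theta> \<in> {0<..<1}"
    "g (y + 1 *\<^sub>R h) - g (y + 0 *\<^sub>R h) = g' (y + \<theta> *\<^sub>R h) ((1 - 0) *\<^sub>R h)"
    using mvt_simple[of 0 1 "\<lambda>t. g (y + t *\<^sub>R h)" "\<lambda>t r. g' (y + t *\<^sub>R h) (r *\<^sub>R h)"] by auto
  then show thesis using that[of \<theta>] by auto
qed

text \<open>Links the mean value theorem, which yields full derivatives, to the coordinate partials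
  in which smoothness is phrased.\<close>

lemma frechet_derivative_eq_sum_partial:
  fixes g :: "'a::euclidean_space \<Rightarrow> real"
  assumes "g differentiable (at z)"
  shows "frechet_derivative g (at z) h = (\<Sum>b\<in>Basis. (h \<bullet> b) * partial_deriv b g z)"
proof -
  have lin: "linear (frechet_derivative g (at z))"
    using assms by (rule linear_frechet_derivative)
  have "frechet_derivative g (at z) h = frechet_derivative g (at z) (\<Sum>b\<in>Basis. (h \<bullet> b) *\<^sub>R b)"
    by (simp add: euclidean_representation)
  also have "\<dots> = (\<Sum>b\<in>Basis. (h \<bullet> b) * partial_deriv b g z)"
    by (simp add: linear_sum[OF lin] linear_cmul[OF lin] partial_deriv_def)
  finally show ?thesis .
qed

lemma smooth_fun_differentiable:
  assumes "smooth_fun f" "set bs \<subseteq> Basis"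
  shows "iterated_partial bs f differentiable (at x)"
proof -
  have "Ck_on (Suc (length bs)) f UNIV" using assms(1) by (simp add: smooth_fun_def)
  then show ?thesis using assms(2) by (simp add: Ck_on_def)
qed

lemma smooth_fun_continuous_on:
  assumes "smooth_fun f" "set bs \<subseteq> Basis"
  shows "continuous_on UNIV (iterated_partial bs f)"
proof -
  have "Ck_on (length bs) f UNIV" using assms(1) by (simp add: smooth_fun_def)
  then show ?thesis using assms(2) by (simp add: Ck_on_def)
qed

text \<open>Two mean values: the first turns the increment of f(z) - f(z-h) into a difference of
  gradients at points \<open>h\<close> apart, the second turns that into second derivatives. The
  square of the dimension counts pairs of coordinates. Asking for \<open>B\<close> only on the ball
  around \<open>x\<close> lets it decay with \<open>x\<close> in the Schwartz case.\<close>

lemma second_difference_bound: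
  fixes f :: "'a::euclidean_space \<Rightarrow> real"
  assumes f: "smooth_fun f"
    and B: "\<And>z b c. z \<in> cball x (norm h) \<Longrightarrow> b \<in> Basis \<Longrightarrow> c \<in> Basis \<Longrightarrow> \<bar>iterated_partial [c, b] f z\<bar> \<le> B"
  shows "\<bar>second_difference f x h\<bar> \<le> (real DIM('a))\<^sup>2 * B * (norm h)\<^sup>2"
proof -
  have f1: "(f has_derivative frechet_derivative f (at z)) (at z)" for z
    using smooth_fun_differentiable[OF f, of "[]"] by (simp add: frechet_derivative_works)
  have f2: "(partial_deriv b f has_derivative frechet_derivative (partial_deriv b f) (at z)) (at z)" if "b \<in> Basis" for b z
    using smooth_fun_differentiable[OF f, of "[b]"] that by (simp add: frechet_derivative_works)
  let ?\<psi> = "\<lambda>z. f z - f (z - h)"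
  have "(?\<psi> has_derivative (\<lambda>k. frechet_derivative f (at z) k - frechet_derivative f (at (z - h)) k)) (at z)" for z
    by (intro derivative_intros f1 has_derivative_compose[OF _ f1, of "\<lambda>z. z - h"])
       (auto intro!: derivative_eq_intros)
  from line_mean_value[OF this, of x h] obtain \<theta> where \<theta>: "0 < \<theta>" "\<theta> < 1"
    and eq: "?\<psi> (x + h) - ?\<psi> x = frechet_derivative f (at (x + \<theta> *\<^sub>R h)) h - frechet_derivative f (at (x + \<theta> *\<^sub>R h - h)) h"
    by blast
  define y where "y = x + \<theta> *\<^sub>R h - h"
  have bound: "\<bar>partial_deriv b f (y + h) - partial_deriv b f y\<bar> \<le> DIM('a) * (norm h * B)" if b: "b \<in> Basis" for b
  proof -
    from line_mean_value[OF f2[OF b], of y h] obtain \<tau> where \<tau>: "0 < \<tau>" "\<tau> < 1"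
      and eq: "partial_deriv b f (y + h) - partial_deriv b f y = frechet_derivative (partial_deriv b f) (at (y + \<tau> *\<^sub>R h)) h"
      by blast
    \<comment> \<open>The intermediate point is x + (theta + tau - 1) h with theta and tau in (0,1),
      so it stays within |h| of \<open>x\<close>.\<close>
    have "y + \<tau> *\<^sub>R h - x = (\<theta> + \<tau> - 1) *\<^sub>R h" unfolding y_def by (simp add: algebra_simps)
    then have "norm (y + \<tau> *\<^sub>R h - x) = \<bar>\<theta> + \<tau> - 1\<bar> * norm h" by simp
    also have "\<dots> \<le> 1 * norm h" using \<theta> \<tau> by (intro mult_right_mono) auto
    finally have z: "y + \<tau> *\<^sub>R h \<in> cball x (norm h)" by (simp add: dist_norm norm_minus_commute)
    have "partial_deriv b f (y + h) - partial_deriv b f y = (\<Sum>c\<in>Basis. (h \<bullet> c) * iterated_partial [c, b] f (y + \<tau> *\<^sub>R h))"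
      unfolding eq using smooth_fun_differentiable[OF f, of "[b]"] b
      by (subst frechet_derivative_eq_sum_partial) auto
    also have "\<bar>\<dots>\<bar> \<le> (\<Sum>c\<in>(Basis::'a set). norm h * B)"
      by (intro order_trans[OF sum_abs] sum_mono, unfold abs_mult, intro mult_mono B z b)
         (auto simp: Basis_le_norm)
    finally show ?thesis by simp
  qed
  have "- second_difference f x h = ?\<psi> (x + h) - ?\<psi> x" by (simp add: second_difference_def)
  also have "\<dots> = frechet_derivative f (at (y + h)) h - frechet_derivative f (at y) h"
    unfolding eq y_def by simp
  also have "\<dots> = (\<Sum>b\<in>Basis. (h \<bullet> b) * (partial_deriv b f (y + h) - partial_deriv b f y))"
    using smooth_fun_differentiable[OF f, of "[]"]
    by (simp add: frechet_derivative_eq_sum_partial sum_subtractf right_diff_distrib)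
  also have "\<bar>\<dots>\<bar> \<le> (\<Sum>b\<in>(Basis::'a set). norm h * (DIM('a) * (norm h * B)))"
    by (intro order_trans[OF sum_abs] sum_mono, unfold abs_mult, intro mult_mono bound)
       (auto simp: Basis_le_norm)
  finally show ?thesis by (simp add: power2_eq_square mult_ac)
qed

text \<open>For |h| \<le> 1, compactness bounds the second derivatives on the unit ball around
  \<open>x\<close>; for larger h, boundedness of \<open>f\<close> suffices. \<open>K\<close> may
  depend on \<open>x\<close>, as the derivatives of \<open>f\<close> need not be globally
  bounded.\<close>

lemma second_difference_bound_bounded:
  fixes f :: "'a::euclidean_space \<Rightarrow> real"
  assumes f: "smooth_fun f" and bdd: "bounded (range f)"
  obtains K where "\<And>h. \<bar>second_difference f x h\<bar> \<le> K * min 1 ((norm h)\<^sup>2)"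
proof -
  obtain A where A: "\<And>x. \<bar>f x\<bar> \<le> A" using bdd by (auto simp: bounded_iff)
  have "\<exists>B. \<forall>z\<in>cball x 1. \<bar>iterated_partial [c, b] f z\<bar> \<le> B" if "b \<in> Basis" "c \<in> Basis" for b c
  proof -
    have "compact (iterated_partial [c, b] f ` cball x 1)"
      using smooth_fun_continuous_on[OF f, of "[c, b]"] that
      by (intro compact_continuous_image continuous_on_subset[OF smooth_fun_continuous_on[OF f]]) auto
    from compact_imp_bounded[OF this] show ?thesis by (auto simp: bounded_iff)
  qed
  then obtain B where B: "\<And>b c z. b \<in> Basis \<Longrightarrow> c \<in> Basis \<Longrightarrow> z \<in> cball x 1 \<Longrightarrow> \<bar>iterated_partial [c, b] f z\<bar> \<le> B b c"
    by metis
  define B' where "B' = (\<Sum>b\<in>Basis. \<Sum>c\<in>Basis. \<bar>B b c\<bar>)"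
  have B': "\<bar>iterated_partial [c, b] f z\<bar> \<le> B'" if "b \<in> Basis" "c \<in> Basis" "z \<in> cball x 1" for b c z
  proof -
    have "\<bar>iterated_partial [c, b] f z\<bar> \<le> \<bar>B b c\<bar>" using B[OF that] by simp
    also have "\<dots> \<le> (\<Sum>c\<in>Basis. \<bar>B b c\<bar>)" using that by (intro member_le_sum) auto
    also have "\<dots> \<le> B'" unfolding B'_def using that by (intro member_le_sum) (auto intro: sum_nonneg)
    finally show ?thesis .
  qed
  have "B' \<ge> 0" unfolding B'_def by (intro sum_nonneg) auto
  have A0: "A \<ge> 0" using A[of x] by linarith
  show thesis
  proof (rule that[of "(real DIM('a))\<^sup>2 * B' + 4 * A"])
    fix h :: 'a
    have 1: "\<bar>second_difference f x h\<bar> \<le> 4 * A"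
      using A[of x] A[of "x + h"] A[of "x - h"] unfolding second_difference_def by linarith
    show "\<bar>second_difference f x h\<bar> \<le> ((real DIM('a))\<^sup>2 * B' + 4 * A) * min 1 ((norm h)\<^sup>2)"
    proof (cases "norm h \<le> 1")
      case True
      have "\<bar>second_difference f x h\<bar> \<le> (real DIM('a))\<^sup>2 * B' * (norm h)\<^sup>2"
        using True by (intro second_difference_bound f B') auto
      moreover have "min 1 ((norm h)\<^sup>2) = (norm h)\<^sup>2" using True by (simp add: abs_square_le_1)
      ultimately show ?thesis using A0 by (simp add: distrib_right add_increasing2)
    next
      case False
      then have "min 1 ((norm h)\<^sup>2) = 1" by (simp add: min_def abs_square_le_1)
      then show ?thesis using 1 \<open>B' \<ge> 0\<close> by (simp add: add_increasing)
    qed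
  qed
qed

lemma smooth_fun_borel_measurable:
  "smooth_fun f \<Longrightarrow> f \<in> borel_measurable borel"
  using smooth_fun_continuous_on[of f "[]"] by (simp add: borel_measurable_continuous_onI)

lemma second_difference_measurable:
  fixes f :: "'a::euclidean_space \<Rightarrow> real"
  assumes [measurable]: "f \<in> borel_measurable borel"
  shows "second_difference f x \<in> borel_measurable borel"
  unfolding second_difference_def by measurable

lemma pv_frac_integral_eq:
  fixes f :: "real^'n \<Rightarrow> real" and s :: real
  assumes s: "0 < s" "s < 1" and f: "smooth_fun f" and bdd: "bounded (range f)"
  shows "pv_frac_integral s f x =
    (LINT h|lborel. second_difference f x h * norm h powr (-(CARD('n) + 2 * s))) / 2"
proof -
  define p where "p = real CARD('n) + 2 * s"
  have p: "real DIM(real^'n) < p" "p < real DIM(real^'n) + 2" using s by (auto simp: p_def)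
  note [measurable] = smooth_fun_borel_measurable[OF f] second_difference_measurable[OF smooth_fun_borel_measurable[OF f]]
  let ?D = "second_difference f x"
  obtain A where A: "\<And>x. \<bar>f x\<bar> \<le> A" using bdd by (auto simp: bounded_iff)
  have A0: "A \<ge> 0" using A[of x] by linarith
  obtain K where K: "\<And>h. \<bar>?D h\<bar> \<le> K * min 1 ((norm h)\<^sup>2)"
    using second_difference_bound_bounded[OF f bdd] by metis
  have intD: "integrable lborel (\<lambda>h. ?D h * norm h powr (-p))"
    using K by (intro integrable_min_norm_bound[OF p]) auto
  \<comment> \<open>Off a ball the two one-sided integrands are separately integrable, so the
    integral may be reflected and split. Without the cut-off, integrability is at hand only for the
    symmetrised integrand.\<close>
  have trunc: "(LINT \<xi>:{\<xi>. norm (x - \<xi>) > \<epsilon>}|lborel. (f x - f \<xi>) / norm (x - \<xi>) powr (real CARD('n) + 2 * s))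
      = (LINT h|lborel. (if norm h > \<epsilon> then ?D h * norm h powr (-p) else 0) / 2)"
    if \<epsilon>: "\<epsilon> > 0" for \<epsilon>
  proof -
    define g where "g \<xi> = (if norm (\<xi> - x) > \<epsilon> then f x - f \<xi> else 0) * norm (\<xi> - x) powr (-p)" for \<xi>
    have int: "integrable lborel (\<lambda>h. g (x + c *\<^sub>R h))" if c: "\<bar>c\<bar> = 1" for c
    proof -
      have "integrable lborel (\<lambda>h. (if norm h > \<epsilon> then f x - f (x + c *\<^sub>R h) else 0) * norm h powr (-p))"
      proof (rule integrable_min_norm_bound[OF p])
        fix h :: "real^'n"
        show "\<bar>if norm h > \<epsilon> then f x - f (x + c *\<^sub>R h) else 0\<bar> \<le> (2 * A * (1 + 1 / \<epsilon>\<^sup>2)) * min 1 ((norm h)\<^sup>2)"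
        proof (cases "norm h > \<epsilon>")
          case True
          \<comment> \<open>For |h| > eps the factor 1 + 1/eps^2 lifts min(1, |h|^2) above 1, which
            puts the constant bound 2A into the required form. It blows up as eps tends to 0 and
            serves fixed eps only; the limit is dominated through \<open>?D\<close>.\<close>
          have "1 \<le> (1 + 1 / \<epsilon>\<^sup>2) * min 1 ((norm h)\<^sup>2)"
          proof (cases "1 \<le> (norm h)\<^sup>2")
            case True
            then show ?thesis by (simp add: min_absorb1)
          next
            case False
            have "\<epsilon>\<^sup>2 \<le> (norm h)\<^sup>2" using \<open>norm h > \<epsilon>\<close> \<epsilon> by (intro power_mono) auto
            then have "1 \<le> 1 / \<epsilon>\<^sup>2 * (norm h)\<^sup>2" using \<epsilon> by (simp add: field_simps)
            then show ?thesis using False by (simp add: min_absorb2 distrib_right add_increasing)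
          qed
          from mult_left_mono[OF this, of "2 * A"] A0
          have "2 * A \<le> (2 * A * (1 + 1 / \<epsilon>\<^sup>2)) * min 1 ((norm h)\<^sup>2)" by (simp add: mult.assoc)
          moreover have "\<bar>f x - f (x + c *\<^sub>R h)\<bar> \<le> 2 * A" using A[of x] A[of "x + c *\<^sub>R h"] by linarith
          ultimately show ?thesis using True by simp
        qed (use A0 in auto)
      qed measurable
      then show ?thesis unfolding g_def using c by simp
    qed
    have "(LINT \<xi>:{\<xi>. norm (x - \<xi>) > \<epsilon>}|lborel. (f x - f \<xi>) / norm (x - \<xi>) powr (real CARD('n) + 2 * s)) = (LINT \<xi>|lborel. g \<xi>)"
      unfolding set_lebesgue_integral_def g_def p_def[symmetric]
      by (intro Bochner_Integration.integral_cong refl)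
         (auto simp: norm_minus_commute powr_minus_divide split: split_indicator)
    \<comment> \<open>The average of the substitutions xi = x + h and xi = x - h.\<close>
    also have "\<dots> = ((LINT h|lborel. g (x + 1 *\<^sub>R h)) + (LINT h|lborel. g (x + (-1) *\<^sub>R h))) / 2"
      using integral_lborel_affine[of 1 g x] integral_lborel_affine[of "-1" g x] by simp
    also have "(LINT h|lborel. g (x + 1 *\<^sub>R h)) + (LINT h|lborel. g (x + (-1) *\<^sub>R h)) =
        (LINT h|lborel. g (x + 1 *\<^sub>R h) + g (x + (-1) *\<^sub>R h))"
      by (rule Bochner_Integration.integral_add[symmetric]) (rule int; simp)+
    also have "\<dots> / 2 = (LINT h|lborel. (g (x + 1 *\<^sub>R h) + g (x + (-1) *\<^sub>R h)) / 2)" by simp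
    also have "\<dots> = (LINT h|lborel. (if norm h > \<epsilon> then ?D h * norm h powr (-p) else 0) / 2)"
      by (intro Bochner_Integration.integral_cong refl)
         (auto simp: g_def second_difference_def algebra_simps)
    finally show ?thesis .
  qed
  have "((\<lambda>\<epsilon>. LINT h|lborel. (if norm h > \<epsilon> then ?D h * norm h powr (-p) else 0) / 2) \<longlongrightarrow>
     (LINT h|lborel. ?D h * norm h powr (-p) / 2)) (at_right 0)"
  proof (rule integral_tendsto_at_within)
    show "integrable lborel (\<lambda>h. \<bar>?D h * norm h powr (-p)\<bar>)" using intD by (rule integrable_abs)
    fix h :: "real^'n"
    show "((\<lambda>\<epsilon>. (if norm h > \<epsilon> then ?D h * norm h powr (-p) else 0) / 2) \<longlongrightarrow> ?D h * norm h powr (-p) / 2) (at_right 0)"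
    proof (cases "h = 0")
      case False
      then have "\<forall>\<^sub>F \<epsilon> in at_right 0. (if norm h > \<epsilon> then ?D h * norm h powr (-p) else 0) / 2 = ?D h * norm h powr (-p) / 2"
        unfolding eventually_at_right_field by (intro exI[of _ "norm h"]) auto
      then show ?thesis by (rule tendsto_eventually)
    qed (simp add: second_difference_def cong: if_cong)
  qed auto
  moreover have "\<forall>\<^sub>F \<epsilon> in at_right 0. (LINT h|lborel. (if norm h > \<epsilon> then ?D h * norm h powr (-p) else 0) / 2) =
     (LINT \<xi>:{\<xi>. norm (x - \<xi>) > \<epsilon>}|lborel. (f x - f \<xi>) / norm (x - \<xi>) powr (real CARD('n) + 2 * s))"
    using eventually_at_right_less[of 0] by eventually_elim (simp only: trunc)
  ultimately have "((\<lambda>\<epsilon>. LINT \<xi>:{\<xi>. norm (x - \<xi>) > \<epsilon>}|lborel. (f x - f \<xi>) / norm (x - \<xi>) powr (real CARD('n) + 2 * s)) \<longlongrightarrow>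
     (LINT h|lborel. ?D h * norm h powr (-p) / 2)) (at_right 0)"
    by (rule Lim_transform_eventually)
  \<comment> \<open>\<open>Lim\<close> is a definite description, so it can be evaluated once
    convergence is known.\<close>
  then have "pv_frac_integral s f x = (LINT h|lborel. ?D h * norm h powr (-p) / 2)"
    unfolding pv_frac_integral_def by (intro tendsto_Lim) auto
  then show ?thesis unfolding p_def by simp
qed

subsection \<open>The regularised kernel\<close>

text \<open>Regularising by y^2 only lowers the kernel, so the singular kernel is a majorant uniform
  in y.\<close>

lemma powr_add_square_le:
  fixes r y q :: real
  assumes "0 < r" "0 \<le> q"
  shows "(r\<^sup>2 + y\<^sup>2) powr (-q / 2) \<le> r powr (-q)"
proof -
  have "(r\<^sup>2 + y\<^sup>2) powr (-q / 2) \<le> (r\<^sup>2) powr (-q / 2)"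
    using assms by (intro powr_mono2') auto
  also have "\<dots> = (r powr 2) powr (-q / 2)" using assms by simp
  also have "\<dots> = r powr (-q)" unfolding powr_powr by simp
  finally show ?thesis .
qed

context
  fixes D :: "'a::euclidean_space \<Rightarrow> real" and K q :: real
  assumes q: "real DIM('a) < q" "q < real DIM('a) + 2"
    and D[measurable]: "D \<in> borel_measurable borel"
    and K: "\<And>h. \<bar>D h\<bar> \<le> K * min 1 ((norm h)\<^sup>2)"
begin

private lemma q_pos: "q > 0"
  using q by (metis of_nat_0_le_iff order_le_less_trans)

text \<open>At h = 0 the term \<open>norm h powr (-q)\<close> has the default value 0 while the
  regularised kernel is positive for y > 0; the vanishing of \<open>D\<close> there keeps the
  domination valid at every point.\<close>

private lemma D_zero: "D 0 = 0"
  using K[of 0] by simp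

private lemma int_D: "integrable lborel (\<lambda>h. D h * norm h powr (-q))"
  by (rule integrable_min_norm_bound[OF q D K])

private lemma kernel_bound:
  "\<bar>D h * ((norm h)\<^sup>2 + y\<^sup>2) powr (-q / 2)\<bar> \<le> \<bar>D h * norm h powr (-q)\<bar>"
  using powr_add_square_le[of "norm h" q y] q_pos D_zero
  by (cases "h = 0") (auto simp: abs_mult intro: mult_left_mono)

private lemma int_kernel: "integrable lborel (\<lambda>h. D h * ((norm h)\<^sup>2 + y\<^sup>2) powr (-q / 2))"
  using kernel_bound by (intro Bochner_Integration.integrable_bound[OF int_D]) auto

text \<open>The factor y^2 makes up for the lower exponent, because y^2 / (|h|^2 + y^2) \<le>
  1.\<close>

private lemma kernel_deriv_bound:
  assumes "y > 0"
  shows "\<bar>y\<^sup>2 * (D h * ((norm h)\<^sup>2 + y\<^sup>2) powr (-q / 2 - 1))\<bar> \<le> \<bar>D h * norm h powr (-q)\<bar>"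
proof -
  have pos: "(norm h)\<^sup>2 + y\<^sup>2 > 0" using assms by (simp add: add_nonneg_pos)
  have "y\<^sup>2 * (D h * ((norm h)\<^sup>2 + y\<^sup>2) powr (-q / 2 - 1)) =
     (y\<^sup>2 / ((norm h)\<^sup>2 + y\<^sup>2)) * (D h * ((norm h)\<^sup>2 + y\<^sup>2) powr (-q / 2))"
    using pos by (simp add: powr_diff)
  also have "\<bar>\<dots>\<bar> = (y\<^sup>2 / ((norm h)\<^sup>2 + y\<^sup>2)) * \<bar>D h * ((norm h)\<^sup>2 + y\<^sup>2) powr (-q / 2)\<bar>"
    by (simp add: abs_mult)
  also have "\<dots> \<le> 1 * \<bar>D h * ((norm h)\<^sup>2 + y\<^sup>2) powr (-q / 2)\<bar>"
    using pos by (intro mult_right_mono) (auto simp: divide_le_eq)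
  finally show ?thesis using kernel_bound[of h y] by simp
qed

lemma kernel_integral_tendsto:
  "((\<lambda>y. LINT h|lborel. D h * ((norm h)\<^sup>2 + y\<^sup>2) powr (-q / 2)) \<longlongrightarrow>
     (LINT h|lborel. D h * norm h powr (-q))) (at_right 0)"
proof (rule integral_tendsto_at_within[where w = "\<lambda>h. \<bar>D h * norm h powr (-q)\<bar>"])
  fix h :: 'a
  show "((\<lambda>y. D h * ((norm h)\<^sup>2 + y\<^sup>2) powr (-q / 2)) \<longlongrightarrow> D h * norm h powr (-q)) (at_right 0)"
  proof (cases "h = 0")
    case False
    have "((\<lambda>y. D h * ((norm h)\<^sup>2 + y\<^sup>2) powr (-q / 2)) \<longlongrightarrow> D h * ((norm h)\<^sup>2 + 0\<^sup>2) powr (-q / 2)) (at_right 0)"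
      using False by (intro tendsto_intros) auto
    moreover have "((norm h)\<^sup>2 + 0\<^sup>2) powr (-q / 2) = norm h powr (-q)"
      using False by (simp add: powr_numeral[symmetric] powr_powr del: powr_numeral)
    ultimately show ?thesis by simp
  qed (simp add: D_zero)
qed (use int_D kernel_bound in auto)

text \<open>Differentiation under the integral: a derivative bound uniform near \<open>y\<close>
  passes to difference quotients by the mean value inequality, and these converge under a common
  majorant.\<close>

lemma kernel_integral_deriv:
  assumes y: "y > 0"
  shows "((\<lambda>y. LINT h|lborel. D h * ((norm h)\<^sup>2 + y\<^sup>2) powr (-q / 2)) has_real_derivative
     (LINT h|lborel. - q * y * (D h * ((norm h)\<^sup>2 + y\<^sup>2) powr (-q / 2 - 1)))) (at y)"
proof -
  let ?g = "\<lambda>y h. D h * ((norm h)\<^sup>2 + y\<^sup>2) powr (-q / 2)"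
  let ?g' = "\<lambda>y h. - q * y * (D h * ((norm h)\<^sup>2 + y\<^sup>2) powr (-q / 2 - 1))"
  let ?S = "{y / 2<..}"
  have der: "((\<lambda>z. ?g z h) has_real_derivative ?g' z h) (at z)" if "z > 0" for z h
  proof -
    have "(norm h)\<^sup>2 + z\<^sup>2 > 0" using that by (simp add: add_nonneg_pos)
    then show ?thesis by (auto intro!: derivative_eq_intros)
  qed
  have bound: "\<bar>?g' z h\<bar> \<le> 2 * q / y * \<bar>D h * norm h powr (-q)\<bar>" if z: "z \<in> ?S" for z h
  proof -
    have z0: "z > 0" "1 / z \<le> 2 / y" using z y by (auto simp: field_simps)
    have "?g' z h = - (q / z) * (z\<^sup>2 * (D h * ((norm h)\<^sup>2 + z\<^sup>2) powr (-q / 2 - 1)))"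
      using z0 by (simp add: power2_eq_square)
    also have "\<bar>\<dots>\<bar> = q * (1 / z) * \<bar>z\<^sup>2 * (D h * ((norm h)\<^sup>2 + z\<^sup>2) powr (-q / 2 - 1))\<bar>"
      using z0 q_pos by (simp add: abs_mult)
    also have "\<dots> \<le> q * (2 / y) * \<bar>D h * norm h powr (-q)\<bar>"
      using z0 q_pos y by (intro mult_mono kernel_deriv_bound mult_left_mono) auto
    finally show ?thesis by (simp add: mult_ac)
  qed
  have "((\<lambda>z. LINT h|lborel. (?g z h - ?g y h) / (z - y)) \<longlongrightarrow> (LINT h|lborel. ?g' y h)) (at y within ?S)"
  proof (rule integral_tendsto_at_within[where w = "\<lambda>h. 2 * q / y * \<bar>D h * norm h powr (-q)\<bar>"])
    fix h :: 'a
    show "((\<lambda>z. (?g z h - ?g y h) / (z - y)) \<longlongrightarrow> ?g' y h) (at y within ?S)"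
      using DERIV_subset[OF der[OF y] subset_UNIV] unfolding has_field_derivative_iff .
    fix z assume z: "z \<in> ?S - {y}"
    have "norm (?g z h - ?g y h) \<le> 2 * q / y * \<bar>D h * norm h powr (-q)\<bar> * norm (z - y)"
    proof (rule field_differentiable_bound[of ?S "\<lambda>z. ?g z h" "\<lambda>z. ?g' z h"])
      fix t assume t: "t \<in> ?S"
      then have "t > 0" using y by auto
      from der[OF this] show "((\<lambda>z. ?g z h) has_real_derivative ?g' t h) (at t within ?S)"
        by (rule DERIV_subset) simp
      show "norm (?g' t h) \<le> 2 * q / y * \<bar>D h * norm h powr (-q)\<bar>"
        using bound[OF t] by simp
    qed (use z y in auto)
    then show "\<bar>(?g z h - ?g y h) / (z - y)\<bar> \<le> 2 * q / y * \<bar>D h * norm h powr (-q)\<bar>"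
      using z by (simp add: divide_le_eq)
  next
    show "integrable lborel (\<lambda>h. 2 * q / y * \<bar>D h * norm h powr (-q)\<bar>)"
      by (intro integrable_mult_right integrable_abs int_D)
  qed auto
  moreover have "(LINT h|lborel. (?g z h - ?g y h) / (z - y)) =
      ((LINT h|lborel. ?g z h) - (LINT h|lborel. ?g y h)) / (z - y)" for z
    by (simp only: integral_divide_zero Bochner_Integration.integral_diff[OF int_kernel int_kernel])
  moreover have "at y within ?S = at y" using y by (intro at_within_open) auto
  ultimately show ?thesis unfolding has_field_derivative_iff by (simp only:)
qed

text \<open>Multiplying by y produces the factor y^2 / (|h|^2 + y^2) next to the kernel; it is at
  most 1 and tends to 0 for h \<noteq> 0. No growth rate for the derivative itself is
  involved.\<close>

lemma kernel_integral_deriv_tendsto: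
  "((\<lambda>y. y * (LINT h|lborel. - q * y * (D h * ((norm h)\<^sup>2 + y\<^sup>2) powr (-q / 2 - 1)))) \<longlongrightarrow> 0) (at_right 0)"
proof -
  have "((\<lambda>y. LINT h|lborel. y\<^sup>2 * (D h * ((norm h)\<^sup>2 + y\<^sup>2) powr (-q / 2 - 1))) \<longlongrightarrow> (LINT h|(lborel :: 'a measure). 0)) (at_right 0)"
  proof (rule integral_tendsto_at_within[where w = "\<lambda>h. \<bar>D h * norm h powr (-q)\<bar>"])
    fix h :: 'a
    show "((\<lambda>y. y\<^sup>2 * (D h * ((norm h)\<^sup>2 + y\<^sup>2) powr (-q / 2 - 1))) \<longlongrightarrow> 0) (at_right 0)"
    proof (cases "h = 0")
      case False
      have "((\<lambda>y. y\<^sup>2 * (D h * ((norm h)\<^sup>2 + y\<^sup>2) powr (-q / 2 - 1))) \<longlongrightarrow> 0\<^sup>2 * (D h * ((norm h)\<^sup>2 + 0\<^sup>2) powr (-q / 2 - 1))) (at_right 0)"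
        using False by (intro tendsto_intros) auto
      then show ?thesis by simp
    qed (simp add: D_zero)
  qed (use int_D kernel_deriv_bound in auto)
  then have "((\<lambda>y. - q * (LINT h|lborel. y\<^sup>2 * (D h * ((norm h)\<^sup>2 + y\<^sup>2) powr (-q / 2 - 1)))) \<longlongrightarrow> - q * 0) (at_right 0)"
    by (intro tendsto_intros) simp
  then show ?thesis by (simp add: power2_eq_square mult_ac)
qed

end

subsection \<open>The normalising constant of the fractional Laplacian\<close>

text \<open>The exponent n + 1 lies in the window (n, n + 2), so the earlier integrability result
  handles the outside of the unit ball.\<close>

lemma integrable_inverse_one_plus_norm:
  "integrable lborel (\<lambda>x::'a::euclidean_space. 1 / (1 + norm x) ^ (DIM('a) + 1))"
proof (rule Bochner_Integration.integrable_bound)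
  let ?p = "real DIM('a) + 1"
  show "integrable lborel (\<lambda>x::'a. indicator (cball 0 1) x + min 1 ((norm x)\<^sup>2) * norm x powr (- ?p))"
    by (intro Bochner_Integration.integrable_add integrable_min_norm_powr integrable_real_indicator)
       (auto simp: emeasure_cball)
  show "AE x::'a in lborel. norm (1 / (1 + norm x) ^ (DIM('a) + 1)) \<le>
    norm (indicator (cball 0 1) x + min 1 ((norm x)\<^sup>2) * norm x powr (- ?p))"
  proof (rule AE_I2)
    fix x :: 'a
    show "norm (1 / (1 + norm x) ^ (DIM('a) + 1)) \<le>
      norm (indicator (cball 0 1) x + min 1 ((norm x)\<^sup>2) * norm x powr (- ?p))"
    proof (cases "norm x \<le> 1")
      case True
      have "1 \<le> (1 + norm x) ^ (DIM('a) + 1)"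
        by (rule one_le_power) simp
      then have "1 / (1 + norm x) ^ (DIM('a) + 1) \<le> 1"
        using divide_left_mono[of 1 "(1 + norm x) ^ (DIM('a) + 1)" 1] by simp
      then show ?thesis using True by (simp add: add_increasing2)
    next
      case False
      then have "1 \<le> (norm x)\<^sup>2" by (simp add: one_le_power)
      moreover have "norm x powr (- ?p) = 1 / norm x ^ (DIM('a) + 1)"
      proof -
        have "norm x powr real (DIM('a) + 1) = norm x ^ (DIM('a) + 1)"
          using False by (intro powr_realpow) auto
        moreover have "real (DIM('a) + 1) = ?p" by simp
        ultimately show ?thesis by (simp only: powr_minus_divide)
      qed
      moreover have "1 / (1 + norm x) ^ (DIM('a) + 1) \<le> 1 / norm x ^ (DIM('a) + 1)"
        using False by (intro divide_left_mono power_mono mult_pos_pos zero_less_power) auto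
      ultimately show ?thesis using False by (simp add: min_absorb1 del: power_Suc)
    qed
  qed
qed simp

text \<open>Since 1 + |x| \<le> 2 max(1, |x|), the seminorms of weight 0 and m together control the
  weight (1 + |x|)^m.\<close>

lemma schwartz_fun_decay:
  fixes f :: "'a::euclidean_space \<Rightarrow> real"
  assumes f: "schwartz_fun f" and bs: "set bs \<subseteq> Basis"
  shows "\<exists>C\<ge>0. \<forall>x. \<bar>iterated_partial bs f x\<bar> \<le> C / (1 + norm x) ^ m"
proof -
  let ?g = "iterated_partial bs f"
  have "\<exists>B. \<forall>x. norm x ^ k * \<bar>?g x\<bar> \<le> B" for k
    using f bs unfolding schwartz_fun_def bounded_iff by (fastforce simp: abs_mult)
  then obtain B where B: "norm x ^ k * \<bar>?g x\<bar> \<le> B k" for k x by metis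
  have "B 0 \<ge> 0" "B m \<ge> 0" using B[of 0 0] B[of 0 m] by (force intro: order_trans[rotated])+
  moreover have "\<bar>?g x\<bar> \<le> (2 ^ m * (B 0 + B m)) / (1 + norm x) ^ m" for x
  proof -
    have "(1 + norm x) ^ m \<le> (2 * max 1 (norm x)) ^ m" by (intro power_mono) auto
    also have "\<dots> = 2 ^ m * max 1 (norm x) ^ m" by (simp add: power_mult_distrib)
    also have "\<dots> \<le> 2 ^ m * (norm x ^ 0 + norm x ^ m)"
      by (intro mult_left_mono) (auto simp: max_def)
    finally have "(1 + norm x) ^ m * \<bar>?g x\<bar> \<le> 2 ^ m * (norm x ^ 0 + norm x ^ m) * \<bar>?g x\<bar>"
      by (rule mult_right_mono) simp
    also have "\<dots> = 2 ^ m * (norm x ^ 0 * \<bar>?g x\<bar> + norm x ^ m * \<bar>?g x\<bar>)" by (simp add: algebra_simps)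
    also have "\<dots> \<le> 2 ^ m * (B 0 + B m)"
      by (intro mult_left_mono add_mono B) auto
    finally show ?thesis by (simp add: pos_le_divide_eq mult.commute add_pos_nonneg)
  qed
  ultimately show ?thesis by (intro exI[of _ "2 ^ m * (B 0 + B m)"]) auto
qed

lemma schwartz_fun_integrable:
  fixes f :: "'a::euclidean_space \<Rightarrow> real"
  assumes f: "schwartz_fun f"
  shows "integrable lborel f"
proof -
  obtain C where "C \<ge> 0" and C: "\<And>x. \<bar>f x\<bar> \<le> C / (1 + norm x) ^ (DIM('a) + 1)"
    using schwartz_fun_decay[OF f, of "[]" "DIM('a) + 1"] by auto
  have [measurable]: "f \<in> borel_measurable borel"
    using f by (auto simp: schwartz_fun_def intro: smooth_fun_borel_measurable)
  have "integrable lborel (\<lambda>x::'a. C * (1 / (1 + norm x) ^ (DIM('a) + 1)))"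
    by (intro integrable_mult_right integrable_inverse_one_plus_norm)
  then show ?thesis
  proof (rule Bochner_Integration.integrable_bound)
    have "norm (f x) \<le> norm (C * (1 / (1 + norm x) ^ (DIM('a) + 1)))" for x
      using C[of x] \<open>C \<ge> 0\<close> by (simp del: power_Suc)
    then show "AE x in lborel. norm (f x) \<le> norm (C * (1 / (1 + norm x) ^ (DIM('a) + 1)))" by simp
  qed simp
qed

lemma schwartz_fun_bounded:
  assumes "schwartz_fun f"
  shows "bounded (range f)"
proof -
  have "bounded (range (\<lambda>x. norm x ^ m * iterated_partial bs f x))" if "set bs \<subseteq> Basis" for m bs
    using assms that by (simp add: schwartz_fun_def)
  from this[of "[]" 0] show ?thesis by simp
qed

text \<open>This supplies the joint integrability for Fubini. For |h| \<le> 1 the second derivatives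
  contribute an integrable weight in x; for larger h, translation invariance gives four times the L1
  norm of \<open>f\<close>.\<close>

lemma schwartz_second_difference_L1:
  fixes f :: "'a::euclidean_space \<Rightarrow> real"
  assumes f: "schwartz_fun f"
  obtains K where "\<And>h. (LINT x|lborel. \<bar>second_difference f x h\<bar>) \<le> K * min 1 ((norm h)\<^sup>2)"
proof -
  obtain m where m: "m = DIM('a) + 1" by simp
  let ?n = "real DIM('a)"
  let ?W = "\<lambda>x::'a. 1 / (1 + norm x) ^ m"
  have W: "integrable lborel ?W" unfolding m by (rule integrable_inverse_one_plus_norm)
  have sm: "smooth_fun f" using f by (simp add: schwartz_fun_def)
  have fi: "integrable lborel f" by (rule schwartz_fun_integrable[OF f])
  have "\<forall>bc \<in> Basis \<times> Basis. \<exists>C\<ge>0. \<forall>x. \<bar>iterated_partial [snd bc, fst bc] f x\<bar> \<le> C / (1 + norm x) ^ m"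
    by (intro ballI schwartz_fun_decay[OF f]) auto
  then obtain C where C: "\<And>bc. bc \<in> Basis \<times> Basis \<Longrightarrow> C bc \<ge> 0"
    "\<And>bc x. bc \<in> Basis \<times> Basis \<Longrightarrow> \<bar>iterated_partial [snd bc, fst bc] f x\<bar> \<le> C bc / (1 + norm x) ^ m"
    by (metis (no_types, lifting))
  define C' where "C' = (\<Sum>bc\<in>Basis \<times> Basis. C bc)"
  have C'0: "C' \<ge> 0" unfolding C'_def using C(1) by (intro sum_nonneg)
  have C': "\<bar>iterated_partial [c, b] f x\<bar> \<le> C' / (1 + norm x) ^ m" if "b \<in> Basis" "c \<in> Basis" for b c x
  proof -
    have "C (b, c) \<le> C'" unfolding C'_def using C(1) that by (intro member_le_sum) auto
    then have "C (b, c) / (1 + norm x) ^ m \<le> C' / (1 + norm x) ^ m" by (intro divide_right_mono) auto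
    then show ?thesis using C(2)[of "(b, c)" x] that by simp
  qed
  have small: "\<bar>second_difference f x h\<bar> \<le> ?n\<^sup>2 * (C' * 2 ^ m) * (norm h)\<^sup>2 * ?W x" if h: "norm h \<le> 1" for x h
  proof -
    have "\<bar>second_difference f x h\<bar> \<le> ?n\<^sup>2 * (C' * 2 ^ m * ?W x) * (norm h)\<^sup>2"
    proof (rule second_difference_bound[OF sm])
      fix z b c :: 'a assume z: "z \<in> cball x (norm h)" and bc: "b \<in> Basis" "c \<in> Basis"
      have "norm x \<le> norm z + norm (x - z)" using norm_triangle_ineq[of z "x - z"] by simp
      \<comment> \<open>Points at distance at most 1 have comparable weights, so decay at z becomes
        decay at x at the cost of 2^m.\<close>
      then have "1 + norm x \<le> 2 * (1 + norm z)" using z h norm_ge_zero[of z] by (simp add: dist_norm del: norm_ge_zero)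
      then have "(1 + norm x) ^ m \<le> (2 * (1 + norm z)) ^ m" by (intro power_mono) auto
      then have "(1 + norm x) ^ m \<le> 2 ^ m * (1 + norm z) ^ m" by (simp only: power_mult_distrib)
      moreover have "(1 + norm x) ^ m > 0" "(1 + norm z) ^ m > 0"
        by (auto intro!: zero_less_power add_pos_nonneg)
      ultimately have "1 / (1 + norm z) ^ m \<le> 2 ^ m * ?W x" by (simp add: field_simps)
      from mult_left_mono[OF this C'0] C'[OF bc, of z]
      show "\<bar>iterated_partial [c, b] f z\<bar> \<le> C' * 2 ^ m * ?W x" by (simp add: mult.assoc)
    qed
    then show ?thesis by (simp add: mult_ac)
  qed
  have ish: "integrable lborel (\<lambda>x. f (x + h))" for h
    using integrable_lborel_affine[OF fi, of 1 h] by (simp add: add.commute)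
  have ish': "(LINT x|lborel. \<bar>f (x + h)\<bar>) = (LINT x|lborel. \<bar>f x\<bar>)" for h
    using integral_lborel_affine[of 1 "\<lambda>x. \<bar>f x\<bar>" h] by (simp add: add.commute)
  have isd: "integrable lborel (\<lambda>x. second_difference f x h)" for h
    unfolding second_difference_def using ish[of h] ish[of "-h"] fi by simp
  let ?I = "LINT x|lborel. \<bar>f x\<bar>"
  have large: "(LINT x|lborel. \<bar>second_difference f x h\<bar>) \<le> 4 * ?I" for h
  proof -
    have "(LINT x|lborel. \<bar>second_difference f x h\<bar>) \<le> (LINT x|lborel. 2 * \<bar>f x\<bar> + \<bar>f (x + h)\<bar> + \<bar>f (x + -h)\<bar>)"
      using fi ish[of h] ish[of "-h"]
      by (intro integral_mono integrable_abs isd) (auto simp: second_difference_def)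
    also have "\<dots> = 4 * ?I"
      using fi ish[of h] ish[of "-h"] ish'[of h] ish'[of "-h"] by simp
    finally show ?thesis .
  qed
  define L where "L = ?n\<^sup>2 * (C' * 2 ^ m) * (LINT x|lborel. ?W x)"
  have L0: "L \<ge> 0" unfolding L_def using C'0 by (intro mult_nonneg_nonneg Bochner_Integration.integral_nonneg) auto
  have I0: "?I \<ge> 0" by (intro Bochner_Integration.integral_nonneg) auto
  show thesis
  proof (rule that[of "L + 4 * ?I"])
    fix h :: 'a
    show "(LINT x|lborel. \<bar>second_difference f x h\<bar>) \<le> (L + 4 * ?I) * min 1 ((norm h)\<^sup>2)"
    proof (cases "norm h \<le> 1")
      case True
      have "(LINT x|lborel. \<bar>second_difference f x h\<bar>) \<le> (LINT x|lborel. ?n\<^sup>2 * (C' * 2 ^ m) * (norm h)\<^sup>2 * ?W x)"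
        using isd small[OF True] W
        by (intro integral_mono integrable_abs integrable_mult_right) auto
      also have "\<dots> = L * (norm h)\<^sup>2" unfolding L_def integral_mult_right_zero by (simp only: mult_ac)
      finally show ?thesis using True I0 by (simp add: abs_square_le_1 min_absorb2 distrib_right add_increasing2)
    next
      case False
      then have "min 1 ((norm h)\<^sup>2) = 1" by (simp add: one_le_power min_absorb1)
      then show ?thesis using large[of h] L0 by (simp add: add_increasing)
    qed
  qed
qed

section \<open>Fourier transform of second differences\<close>

lemma cis_measurable: "cis \<in> borel_measurable borel"
  by (intro borel_measurable_continuous_onI continuous_on_cis continuous_on_id)

lemma fourier_transform_translate:
  fixes f :: "'a::euclidean_space \<Rightarrow> real"
  shows "(LINT x|lborel. cis (- (x \<bullet> \<xi>)) * complex_of_real (f (x + h))) = cis (h \<bullet> \<xi>) * fourier_transform f \<xi>"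
proof -
  have "(LINT x|lborel. cis (- (x \<bullet> \<xi>)) * complex_of_real (f (x + h)))
      = (LINT x|lborel. cis (h \<bullet> \<xi>) * (cis (- ((h + 1 *\<^sub>R x) \<bullet> \<xi>)) * complex_of_real (f (h + 1 *\<^sub>R x))))"
    by (intro Bochner_Integration.integral_cong refl)
       (simp add: cis_mult mult.assoc[symmetric] inner_add_left add.commute)
  also have "\<dots> = cis (h \<bullet> \<xi>) * fourier_transform f \<xi>"
    unfolding fourier_transform_def
    using integral_lborel_affine[of 1 "\<lambda>x. cis (- (x \<bullet> \<xi>)) * complex_of_real (f x)" h] by simp
  finally show ?thesis .
qed

text \<open>Translation by h multiplies the transform by e^(i h.xi), so a second difference carries
  the multiplier 2 - e^(i h.xi) - e^(-i h.xi) = 2 (1 - cos(h.xi)).\<close>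

lemma fourier_transform_second_difference_integral:
  fixes f :: "'a::euclidean_space \<Rightarrow> real" and p :: real
  assumes f: "schwartz_fun f" and p: "real DIM('a) < p" "p < real DIM('a) + 2"
  shows "fourier_transform (\<lambda>x. LINT h|lborel. second_difference f x h * norm h powr (-p)) \<xi> =
    complex_of_real (2 * (LINT h|lborel. (1 - cos (h \<bullet> \<xi>)) * norm h powr (-p))) * fourier_transform f \<xi>"
proof -
  note [measurable] = cis_measurable
  have [measurable]: "f \<in> borel_measurable borel"
    using f by (auto simp: schwartz_fun_def intro: smooth_fun_borel_measurable)
  have fi: "integrable lborel f" by (rule schwartz_fun_integrable[OF f])
  have ish: "integrable lborel (\<lambda>x. cis (- (x \<bullet> \<xi>)) * complex_of_real (f (x + h)))" for h
    using integrable_lborel_affine[OF fi, of 1 h]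
    by (rule Bochner_Integration.integrable_bound) (auto simp: norm_mult add.commute)
  have isd: "integrable lborel (\<lambda>x. second_difference f x h)" for h
    unfolding second_difference_def
    using integrable_lborel_affine[OF fi, of 1 h] integrable_lborel_affine[OF fi, of 1 "-h"] fi
    by (simp add: add.commute)
  define F where "F h x = cis (- (x \<bullet> \<xi>)) * complex_of_real (second_difference f x h * norm h powr (-p))" for h x
  have F_meas [measurable]: "case_prod F \<in> borel_measurable (lborel \<Otimes>\<^sub>M lborel)"
    unfolding F_def second_difference_def by measurable
  have normF: "norm (F h x) = \<bar>second_difference f x h\<bar> * norm h powr (-p)" for h x
    by (simp add: F_def norm_mult abs_mult)
  obtain K where K: "\<And>h. (LINT x|lborel. \<bar>second_difference f x h\<bar>) \<le> K * min 1 ((norm h)\<^sup>2)"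
    using schwartz_second_difference_L1[OF f] by metis
  have meas: "(\<lambda>h. LINT x|lborel. \<bar>second_difference f x h\<bar>) \<in> borel_measurable borel"
    unfolding second_difference_def by measurable
  have int: "integrable (lborel \<Otimes>\<^sub>M lborel) (case_prod F)"
  proof (rule lborel_pair.Fubini_integrable[OF F_meas])
    have "integrable lborel (\<lambda>h. (LINT x|lborel. \<bar>second_difference f x h\<bar>) * norm h powr (-p))"
      using K by (intro integrable_min_norm_bound[OF p meas, of K]) simp
    then show "integrable lborel (\<lambda>h. LINT x|lborel. norm (case_prod F (h, x)))"
      by (simp add: normF)
    show "AE h in lborel. integrable lborel (\<lambda>x. case_prod F (h, x))"
    proof (rule AE_I2)
      fix h :: 'a
      have "integrable lborel (\<lambda>x. second_difference f x h * norm h powr (-p))"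
        using isd by simp
      then show "integrable lborel (\<lambda>x. case_prod F (h, x))"
      proof (rule Bochner_Integration.integrable_bound)
        show "(\<lambda>x. case_prod F (h, x)) \<in> borel_measurable lborel"
          unfolding F_def second_difference_def prod.case by measurable
      qed (simp add: normF abs_mult)
    qed
  qed
  have inner: "(LINT x|lborel. F h x) =
     complex_of_real (2 * ((1 - cos (h \<bullet> \<xi>)) * norm h powr (-p))) * fourier_transform f \<xi>" for h
  proof -
    \<comment> \<open>Writing the unshifted term as \<open>f (x + 0)\<close> lets the translation
      rule cover all three terms.\<close>
    have "(LINT x|lborel. F h x) = (LINT x|lborel. complex_of_real (norm h powr (-p)) *
       (2 * (cis (- (x \<bullet> \<xi>)) * complex_of_real (f (x + 0))) - cis (- (x \<bullet> \<xi>)) * complex_of_real (f (x + h))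
         - cis (- (x \<bullet> \<xi>)) * complex_of_real (f (x + - h))))"
      by (intro Bochner_Integration.integral_cong refl)
         (simp add: F_def second_difference_def algebra_simps)
    also have "\<dots> = complex_of_real (norm h powr (-p)) *
       (2 * (cis (0 \<bullet> \<xi>) * fourier_transform f \<xi>) - cis (h \<bullet> \<xi>) * fourier_transform f \<xi>
         - cis ((- h) \<bullet> \<xi>) * fourier_transform f \<xi>)"
      unfolding fourier_transform_translate[symmetric]
      by (simp only: integral_mult_right_zero Bochner_Integration.integral_diff ish
          Bochner_Integration.integrable_diff integrable_mult_right)
    also have "\<dots> = complex_of_real (norm h powr (-p)) * (2 - cis (h \<bullet> \<xi>) - cis (- (h \<bullet> \<xi>))) * fourier_transform f \<xi>"
      by (simp add: algebra_simps)
    also have "2 - cis (h \<bullet> \<xi>) - cis (- (h \<bullet> \<xi>)) = complex_of_real (2 * (1 - cos (h \<bullet> \<xi>)))"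
      by (simp add: complex_eq_iff)
    finally show ?thesis by (simp add: mult_ac)
  qed
  have "fourier_transform (\<lambda>x. LINT h|lborel. second_difference f x h * norm h powr (-p)) \<xi> =
      (LINT x|lborel. LINT h|lborel. F h x)"
    unfolding fourier_transform_def F_def
    by (intro Bochner_Integration.integral_cong refl) (simp del: of_real_mult)
  also have "\<dots> = (LINT h|lborel. LINT x|lborel. F h x)"
    by (rule lborel_pair.Fubini_integral[OF int])
  also have "\<dots> = complex_of_real (2 * (LINT h|lborel. (1 - cos (h \<bullet> \<xi>)) * norm h powr (-p))) * fourier_transform f \<xi>"
    unfolding inner by (simp del: of_real_mult add: of_real_mult[of 2])
  finally show ?thesis .
qed

lemma frac_laplacian_const_pos:
  fixes s :: real
  assumes s: "0 < s" "s < 1"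
  shows "frac_laplacian_const TYPE('n::finite) s > 0"
proof -
  define p where "p = real CARD('n) + 2 * s"
  have p: "real CARD('n) < p" "p < real CARD('n) + 2" using s by (auto simp: p_def)
  from ex_symbol_const[OF p] obtain c0 where c0: "c0 > 0"
    "\<And>\<xi>::real^'n. (LINT h|lborel. (1 - cos (h \<bullet> \<xi>)) * norm h powr (-p)) = c0 * norm \<xi> powr (p - CARD('n))"
    by blast
  \<comment> \<open>The witness is 1/c0: the 1/2 in the principal value formula cancels the 2 of the
    multiplier, so the principal value integral has symbol c0 |xi|^(2s).\<close>
  have "fourier_transform (\<lambda>x. 1 / c0 * pv_frac_integral s f x) \<xi>
          = complex_of_real (norm \<xi> powr (2 * s)) * fourier_transform f \<xi>"
    if f: "schwartz_fun f" for f :: "real^'n \<Rightarrow> real" and \<xi>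
  proof -
    have "smooth_fun f" using f by (simp add: schwartz_fun_def)
    from pv_frac_integral_eq[OF s this schwartz_fun_bounded[OF f]]
    have pv: "pv_frac_integral s f x = (LINT h|lborel. second_difference f x h * norm h powr (-p)) / 2" for x
      unfolding p_def .
    have "fourier_transform (\<lambda>x. 1 / c0 * pv_frac_integral s f x) \<xi> =
      complex_of_real (1 / (2 * c0)) * fourier_transform (\<lambda>x. LINT h|lborel. second_difference f x h * norm h powr (-p)) \<xi>"
      unfolding fourier_transform_def pv integral_mult_right_zero[symmetric]
      by (intro Bochner_Integration.integral_cong refl) simp
    also have "\<dots> = complex_of_real (1 / (2 * c0) * (2 * (c0 * norm \<xi> powr (p - CARD('n))))) * fourier_transform f \<xi>"
      using p by (subst fourier_transform_second_difference_integral[OF f]) (simp_all add: c0(2))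
    also have "1 / (2 * c0) * (2 * (c0 * norm \<xi> powr (p - CARD('n)))) = norm \<xi> powr (2 * s)"
      using c0(1) by (simp add: p_def)
    finally show ?thesis .
  qed
  then have "\<exists>c>0. \<forall>(f :: real^'n \<Rightarrow> real) \<xi>. schwartz_fun f \<longrightarrow>
        fourier_transform (\<lambda>x. c * pv_frac_integral s f x) \<xi>
          = complex_of_real (norm \<xi> powr (2 * s)) * fourier_transform f \<xi>"
    using c0(1) by (intro exI[of _ "1 / c0"]) auto
  from someI_ex[OF this] show ?thesis
    unfolding frac_laplacian_const_def by blast
qed

subsection \<open>The Poisson extension\<close>

lemma poisson_profile_eq:
  "poisson_profile a (x::real^'n) y =
     y powr (1 - a) * ((norm x)\<^sup>2 + y\<^sup>2) powr (- (real CARD('n) + 1 - a) / 2)"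
  unfolding poisson_profile_def by (simp only: minus_divide_left[symmetric] powr_minus_divide) simp

lemma poisson_profile_measurable [measurable]:
  "(\<lambda>x::real^'n. poisson_profile a x y) \<in> borel_measurable borel"
  unfolding poisson_profile_def by measurable

context
  fixes a :: real
  assumes a: "-1 < a" "a < 1"
begin

lemma integrable_poisson_profile:
  assumes y: "y > 0"
  shows "integrable lborel (\<lambda>x::real^'n. poisson_profile a x y)"
proof -
  define q where "q = real CARD('n) + 1 - a"
  have q: "real DIM(real^'n) < q" "q < real DIM(real^'n) + 2" and q0: "q \<ge> 0"
    using a unfolding q_def by auto
  have "integrable lborel (\<lambda>x::real^'n. y powr (1 - a) * ((y\<^sup>2) powr (- q / 2) * indicator (cball 0 1) x
     + min 1 ((norm x)\<^sup>2) * norm x powr (-q)))"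
    by (intro integrable_mult_right Bochner_Integration.integrable_add integrable_min_norm_powr[OF q] integrable_real_indicator)
       (auto simp: emeasure_cball)
  then show ?thesis
  proof (rule Bochner_Integration.integrable_bound)
    show "AE x::real^'n in lborel. norm (poisson_profile a x y) \<le> norm (y powr (1 - a) * ((y\<^sup>2) powr (- q / 2) * indicator (cball 0 1) x
     + min 1 ((norm x)\<^sup>2) * norm x powr (-q)))"
    proof (rule AE_I2)
      fix x :: "real^'n"
      have "((norm x)\<^sup>2 + y\<^sup>2) powr (- q / 2) \<le> (y\<^sup>2) powr (- q / 2) * indicator (cball 0 1) x
         + min 1 ((norm x)\<^sup>2) * norm x powr (-q)"
      proof (cases "norm x \<le> 1")
        case True
        have "((norm x)\<^sup>2 + y\<^sup>2) powr (- q / 2) \<le> (y\<^sup>2) powr (- q / 2)"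
          using y q0 by (intro powr_mono2') auto
        then show ?thesis using True by (simp add: add_increasing2)
      next
        case False
        then have "min 1 ((norm x)\<^sup>2) = 1" by (simp add: one_le_power min_absorb1)
        moreover have "0 < norm x" using False by linarith
        ultimately show ?thesis using powr_add_square_le[of "norm x" q y] q0 False by simp
      qed
      from mult_left_mono[OF this, of "y powr (1 - a)"]
      show "norm (poisson_profile a x y) \<le> norm (y powr (1 - a) * ((y\<^sup>2) powr (- q / 2) * indicator (cball 0 1) x
        + min 1 ((norm x)\<^sup>2) * norm x powr (-q)))"
        unfolding poisson_profile_eq q_def[symmetric] by simp
    qed
  qed simp
qed

text \<open>Under x -> y x the powers of y add up to n + (1-a) - (n+1-a) = 0, which is why one
  constant normalises the kernel at every height.\<close>

lemma integral_poisson_profile_scale: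
  assumes y: "y > 0"
  shows "(LINT x|lborel. poisson_profile a (x::real^'n) y) = (LINT x|lborel. poisson_profile a (x::real^'n) 1)"
proof -
  define q where "q = real CARD('n) + 1 - a"
  have "(LINT x|lborel. poisson_profile a (x::real^'n) y) = y ^ CARD('n) * (LINT x|lborel. poisson_profile a (y *\<^sub>R x :: real^'n) y)"
    using integral_lborel_affine[of y "\<lambda>x::real^'n. poisson_profile a x y" 0] y by simp
  also have "(LINT x|lborel. poisson_profile a (y *\<^sub>R x :: real^'n) y) =
      (LINT x|lborel. y powr (1 - a) * y powr (-q) * poisson_profile a (x :: real^'n) 1)"
  proof (intro Bochner_Integration.integral_cong refl)
    fix x :: "real^'n"
    have "(norm (y *\<^sub>R x))\<^sup>2 + y\<^sup>2 = (y powr 2) * ((norm x)\<^sup>2 + 1)"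
      using y by (simp add: power_mult_distrib algebra_simps)
    then have "((norm (y *\<^sub>R x))\<^sup>2 + y\<^sup>2) powr (- q / 2) = y powr (-q) * ((norm x)\<^sup>2 + 1) powr (- q / 2)"
      using y by (simp add: powr_mult powr_powr del: powr_numeral)
    then show "poisson_profile a (y *\<^sub>R x) y = y powr (1 - a) * y powr (-q) * poisson_profile a x 1"
      unfolding poisson_profile_eq q_def[symmetric] by simp
  qed
  also have "\<dots> = y powr (1 - a) * y powr (-q) * (LINT x|lborel. poisson_profile a (x :: real^'n) 1)" by simp
  also have "y ^ CARD('n) * \<dots> = y powr (real CARD('n) + (1 - a) + (-q)) * (LINT x|lborel. poisson_profile a (x :: real^'n) 1)"
    using y by (simp only: powr_add powr_realpow mult.assoc)
  finally show ?thesis using y by (simp add: q_def)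
qed

lemma integral_poisson_profile_pos: "(LINT x|lborel. poisson_profile a (x::real^'n) 1) > 0"
proof -
  have pos: "poisson_profile a x 1 > 0" for x :: "real^'n"
  proof -
    have "(norm x)\<^sup>2 + 1\<^sup>2 > 0" by (simp add: add_nonneg_pos)
    then show ?thesis unfolding poisson_profile_def by simp
  qed
  have "(LINT x|lborel. poisson_profile a (x::real^'n) 1) \<noteq> 0"
  proof
    assume "(LINT x|lborel. poisson_profile a (x::real^'n) 1) = 0"
    then have "AE x in lborel. poisson_profile a (x::real^'n) 1 = 0"
      using pos integrable_poisson_profile[of 1]
      by (subst (asm) integral_nonneg_eq_0_iff_AE) (auto intro: less_imp_le)
    then have "AE x::real^'n in lborel. False"
    proof eventually_elim
      case (elim x)
      then show ?case using pos[of x] by simp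
    qed
    then have "emeasure lborel (UNIV :: (real^'n) set) = 0"
      by (subst (asm) AE_iff_measurable[OF _ refl]) auto
    then show False by simp
  qed
  moreover have "(LINT x|lborel. poisson_profile a (x::real^'n) 1) \<ge> 0"
    using pos by (intro Bochner_Integration.integral_nonneg) (auto intro: less_imp_le)
  ultimately show ?thesis by simp
qed

text \<open>Existence for all y rests on the scale invariance; uniqueness is read off at y =
  1.\<close>

lemma poisson_const_eq:
  "poisson_const TYPE('n::finite) a = 1 / (LINT x|lborel. poisson_profile a (x::real^'n) 1)"
  unfolding poisson_const_def
proof (rule the_equality)
  let ?I = "LINT x|lborel. poisson_profile a (x::real^'n) 1"
  have I: "?I > 0" by (rule integral_poisson_profile_pos)
  have one: "(LINT x|lborel. 1 / ?I * poisson_profile a (x :: real^'n) y) = 1" if "y > 0" for y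
    unfolding integral_mult_right_zero integral_poisson_profile_scale[OF that] using I by simp
  from I have "1 / ?I > 0" by simp
  with one show "1 / ?I > 0 \<and> (\<forall>y>0. (LINT x|lborel. 1 / ?I * poisson_profile a (x :: real^'n) y) = 1)"
    by blast
  fix c assume c: "c > 0 \<and> (\<forall>y>0. (LINT x|lborel. c * poisson_profile a (x :: real^'n) y) = 1)"
  then have "(LINT x|lborel. c * poisson_profile a (x :: real^'n) 1) = 1" using zero_less_one by blast
  then have "c * ?I = 1" unfolding integral_mult_right_zero .
  then show "c = 1 / ?I" using I by (simp add: eq_divide_eq)
qed

lemma poisson_const_pos: "poisson_const TYPE('n::finite) a > 0"
  unfolding poisson_const_eq using integral_poisson_profile_pos by simp

lemma integral_poisson_kernel:
  assumes "y > 0"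
  shows "(LINT x|lborel. poisson_kernel a (x::real^'n) y) = 1"
  unfolding poisson_kernel_def poisson_const_eq
  using integral_poisson_profile_pos[where 'n='n] integral_poisson_profile_scale[OF assms, where 'n='n] by simp

lemma poisson_integral_minus_trace:
  fixes f :: "real^'n \<Rightarrow> real"
  assumes [measurable]: "f \<in> borel_measurable borel" and bdd: "bounded (range f)" and y: "y > 0"
  shows "(LINT \<xi>|lborel. poisson_kernel a (x - \<xi>) y * f \<xi>) - f x =
    - (poisson_const TYPE('n) a / 2) * y powr (1 - a) *
      (LINT h|lborel. second_difference f x h * ((norm h)\<^sup>2 + y\<^sup>2) powr (- (real CARD('n) + 1 - a) / 2))"
proof -
  let ?P = "\<lambda>h::real^'n. poisson_kernel a h y" and ?c = "poisson_const TYPE('n) a"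
  obtain A where A: "\<And>x. \<bar>f x\<bar> \<le> A" using bdd by (auto simp: bounded_iff)
  have [measurable]: "(\<lambda>h::real^'n. ?P h) \<in> borel_measurable borel"
    unfolding poisson_kernel_def by measurable
  have Pi: "integrable lborel (\<lambda>h::real^'n. ?P h)"
    unfolding poisson_kernel_def using integrable_poisson_profile[OF y] by (rule integrable_mult_right)
  have even: "?P (-h) = ?P h" for h :: "real^'n"
    unfolding poisson_kernel_def poisson_profile_def by simp
  have Pf: "integrable lborel (\<lambda>h::real^'n. ?P h * f (x + c *\<^sub>R h))" for c
  proof (rule Bochner_Integration.integrable_bound)
    show "integrable lborel (\<lambda>h::real^'n. A * ?P h)" using Pi by (rule integrable_mult_right)
    show "AE h::real^'n in lborel. norm (?P h * f (x + c *\<^sub>R h)) \<le> norm (A * ?P h)"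
    proof (rule AE_I2)
      fix h :: "real^'n"
      have "\<bar>f (x + c *\<^sub>R h)\<bar> \<le> \<bar>A\<bar>" using A[of "x + c *\<^sub>R h"] by linarith
      from mult_right_mono[OF this, of "\<bar>?P h\<bar>"]
      show "norm (?P h * f (x + c *\<^sub>R h)) \<le> norm (A * ?P h)"
        by (simp add: abs_mult mult.commute)
    qed
  qed simp
  have sub: "(LINT \<xi>|lborel. ?P (x - \<xi>) * f \<xi>) = (LINT h|lborel. ?P h * f (x + c *\<^sub>R h))" if "c = 1 \<or> c = -1" for c
    using integral_lborel_affine[of c "\<lambda>\<xi>. ?P (x - \<xi>) * f \<xi>" x] that even by auto
  have Pfx: "integrable lborel (\<lambda>h::real^'n. ?P h * f x)" using Pi by (rule integrable_mult_left)
  \<comment> \<open>Total mass 1 writes \<open>f x\<close> as an integral against the kernel, and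
    evenness lets the substitutions xi = x + h and xi = x - h be averaged.\<close>
  have "(LINT \<xi>|lborel. ?P (x - \<xi>) * f \<xi>) - f x =
     ((LINT h|lborel. ?P h * f (x + 1 *\<^sub>R h)) + (LINT h|lborel. ?P h * f (x + (-1) *\<^sub>R h)) - 2 * (LINT h|lborel. ?P h * f x)) / 2"
    using sub[of 1] sub[of "-1"] integral_poisson_kernel[OF y, where 'n='n] by simp
  also have "(LINT h|lborel. ?P h * f (x + 1 *\<^sub>R h)) + (LINT h|lborel. ?P h * f (x + (-1) *\<^sub>R h)) - 2 * (LINT h|lborel. ?P h * f x)
      = (LINT h|lborel. ?P h * f (x + 1 *\<^sub>R h) + ?P h * f (x + (-1) *\<^sub>R h) - 2 * (?P h * f x))"
    by (simp only: Bochner_Integration.integral_diff Bochner_Integration.integral_add integral_mult_right_zero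
       Pf Pfx integrable_mult_right Bochner_Integration.integrable_add)
  also have "\<dots> = (LINT h|lborel. - ?c * y powr (1 - a) * (second_difference f x h * ((norm h)\<^sup>2 + y\<^sup>2) powr (- (real CARD('n) + 1 - a) / 2)))"
    by (intro Bochner_Integration.integral_cong refl)
       (simp add: poisson_kernel_def poisson_profile_eq second_difference_def algebra_simps)
  also have "\<dots> = - ?c * y powr (1 - a) * (LINT h|lborel. second_difference f x h * ((norm h)\<^sup>2 + y\<^sup>2) powr (- (real CARD('n) + 1 - a) / 2))"
    by (rule integral_mult_right_zero)
  finally show ?thesis by simp
qed

end

section \<open>Limits at the boundary and the change of variable\<close>

text \<open>For y > 0 the extension is f(x) + k y^(1-a) G(y), where G tends to twice the principal
  value. The second limit is 1-a times the first, the factor coming from the derivative of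
  y^(1-a).\<close>

lemma extension_normal_derivative:
  fixes f :: "real^'n \<Rightarrow> real" and s a :: real
  assumes s: "0 < s" "s < 1" and a: "a = 1 - 2 * s"
    and f: "smooth_fun f" and bdd: "bounded (range f)" and u: "is_extension a f u"
  shows "((\<lambda>y. (u x y - u x 0) / y powr (1 - a)) \<longlongrightarrow> - poisson_const TYPE('n) a * pv_frac_integral s f x) (at_right 0)"
    and "((\<lambda>y. y powr a * deriv (u x) y) \<longlongrightarrow>
      (1 - a) * (- poisson_const TYPE('n) a * pv_frac_integral s f x)) (at_right 0)"
proof -
  let ?c = "poisson_const TYPE('n) a" and ?D = "second_difference f x"
  define q where "q = real CARD('n) + 1 - a"
  have a1: "-1 < a" "a < 1" using s a by auto
  have q: "real DIM(real^'n) < q" "q < real DIM(real^'n) + 2" using a1 unfolding q_def by auto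
  have fm: "f \<in> borel_measurable borel" using f by (rule smooth_fun_borel_measurable)
  have Dm: "?D \<in> borel_measurable borel" using fm by (rule second_difference_measurable)
  obtain K where K: "\<And>h. \<bar>?D h\<bar> \<le> K * min 1 ((norm h)\<^sup>2)"
    using second_difference_bound_bounded[OF f bdd] by metis
  define G where "G y = (LINT h|lborel. ?D h * ((norm h)\<^sup>2 + y\<^sup>2) powr (- q / 2))" for y
  define G' where "G' y = (LINT h|lborel. - q * y * (?D h * ((norm h)\<^sup>2 + y\<^sup>2) powr (-q / 2 - 1)))" for y
  have "q = real CARD('n) + 2 * s" unfolding q_def a by simp
  then have pv: "(LINT h|lborel. ?D h * norm h powr (-q)) = 2 * pv_frac_integral s f x"
    using pv_frac_integral_eq[OF s f bdd, of x] by simp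
  have G: "(G \<longlongrightarrow> 2 * pv_frac_integral s f x) (at_right 0)"
    unfolding G_def pv[symmetric] by (rule kernel_integral_tendsto[OF q Dm K])
  have dG: "(G has_real_derivative G' y) (at y)" if "y > 0" for y
    unfolding G_def G'_def by (rule kernel_integral_deriv[OF q Dm K that])
  have yG': "((\<lambda>y. y * G' y) \<longlongrightarrow> 0) (at_right 0)"
    unfolding G'_def by (rule kernel_integral_deriv_tendsto[OF q Dm K])
  \<comment> \<open>The 1/2 stems from averaging the two reflected integrals and cancels the 2 in
    the limit of \<open>G\<close>.\<close>
  obtain k where k: "k = - (?c / 2)" by simp
  have u0: "u x 0 = f x" using u by (simp add: is_extension_def)
  have uy: "u x y = f x + (k * y powr (1 - a) * G y)" if "y > 0" for y
  proof -
    have "u x y = (LINT \<xi>|lborel. poisson_kernel a (x - \<xi>) y * f \<xi>)"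
      using u that by (simp add: is_extension_def)
    then show ?thesis
      using poisson_integral_minus_trace[OF a1 fm bdd that, of x] unfolding G_def q_def k by simp
  qed
  have "((\<lambda>y. k * G y) \<longlongrightarrow> k * (2 * pv_frac_integral s f x)) (at_right 0)"
    by (intro tendsto_intros G)
  moreover have "\<forall>\<^sub>F y in at_right 0. k * G y = (u x y - u x 0) / y powr (1 - a)"
    using eventually_at_right_less[of 0] by eventually_elim (simp add: uy u0)
  ultimately have "((\<lambda>y. (u x y - u x 0) / y powr (1 - a)) \<longlongrightarrow> k * (2 * pv_frac_integral s f x)) (at_right 0)"
    by (rule Lim_transform_eventually)
  then show "((\<lambda>y. (u x y - u x 0) / y powr (1 - a)) \<longlongrightarrow> - ?c * pv_frac_integral s f x) (at_right 0)"
    by (simp add: k)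
  \<comment> \<open>In the product rule y^a cancels y^(-a) and leaves y in front of G', whose
    product with y tends to 0.\<close>
  have du: "y powr a * deriv (u x) y = k * ((1 - a) * G y + y * G' y)" if y: "y > 0" for y
  proof -
    have "((\<lambda>y. f x + (k * y powr (1 - a) * G y)) has_real_derivative
        k * ((1 - a) * y powr (- a) * G y + y powr (1 - a) * G' y)) (at y)"
      using y by (auto intro!: derivative_eq_intros dG simp: algebra_simps)
    then have "(u x has_real_derivative k * ((1 - a) * y powr (- a) * G y + y powr (1 - a) * G' y)) (at y)"
      by (rule has_field_derivative_transform_within_open[where S = "{0<..}"]) (use y in \<open>auto simp: uy\<close>)
    then have "y powr a * deriv (u x) y = k * ((1 - a) * (y powr a * y powr (- a)) * G y + (y powr a * y powr (1 - a)) * G' y)"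
      by (simp add: DERIV_imp_deriv algebra_simps)
    then show ?thesis using y by (simp add: powr_add[symmetric])
  qed
  have "((\<lambda>y. k * ((1 - a) * G y + y * G' y)) \<longlongrightarrow> k * ((1 - a) * (2 * pv_frac_integral s f x) + 0)) (at_right 0)"
    by (intro tendsto_intros G yG')
  moreover have "\<forall>\<^sub>F y in at_right 0. k * ((1 - a) * G y + y * G' y) = y powr a * deriv (u x) y"
    using eventually_at_right_less[of 0] by eventually_elim (simp only: du)
  ultimately have "((\<lambda>y. y powr a * deriv (u x) y) \<longlongrightarrow> k * ((1 - a) * (2 * pv_frac_integral s f x) + 0)) (at_right 0)"
    by (rule Lim_transform_eventually)
  then show "((\<lambda>y. y powr a * deriv (u x) y) \<longlongrightarrow> (1 - a) * (- ?c * pv_frac_integral s f x)) (at_right 0)"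
    by (simp add: k algebra_simps)
qed

text \<open>The map y = b z^(1/b) inverts z = (y/b)^b, so y^b = b^b z and the quotient in z is b^b
  times the quotient by y^b.\<close>

lemma right_derivative_powr_substitution:
  fixes v w :: "real \<Rightarrow> real" and b :: real
  assumes b: "b > 0" and v: "\<And>y. y \<ge> 0 \<Longrightarrow> v ((y / b) powr b) = w y"
    and w: "((\<lambda>y. (w y - w 0) / y powr b) \<longlongrightarrow> M) (at_right 0)"
  shows "(v has_real_derivative b powr b * M) (at_right 0)"
proof -
  have Y: "filterlim (\<lambda>z. b * z powr (1 / b)) (at_right 0) (at_right (0::real))"
    unfolding filterlim_at
  proof
    have "((\<lambda>z. b * z powr (1 / b)) \<longlongrightarrow> b * 0 powr (1 / b)) (at_right 0)"
      \<comment> \<open>The base tends to 0, so the limit relies on the exponent 1/b being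
        positive.\<close>
      using b by (intro tendsto_intros tendsto_powr2 tendsto_const) (auto simp: eventually_at_filter)
    then show "((\<lambda>z. b * z powr (1 / b)) \<longlongrightarrow> 0) (at_right 0)" by simp
    show "\<forall>\<^sub>F z in at_right 0. b * z powr (1 / b) \<in> {0<..} \<and> b * z powr (1 / b) \<noteq> 0"
      using eventually_at_right_less[of 0] by eventually_elim (use b in simp)
  qed
  have "((\<lambda>z. b powr b * ((w (b * z powr (1 / b)) - w 0) / (b * z powr (1 / b)) powr b)) \<longlongrightarrow> b powr b * M) (at_right 0)"
    by (intro tendsto_intros filterlim_compose[OF w Y])
  moreover have "\<forall>\<^sub>F z in at_right 0. b powr b * ((w (b * z powr (1 / b)) - w 0) / (b * z powr (1 / b)) powr b) = (v z - v 0) / (z - 0)"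
    using eventually_at_right_less[of 0]
  proof eventually_elim
    case (elim z)
    have "v z = w (b * z powr (1 / b))"
      using v[of "b * z powr (1 / b)"] b elim by (simp add: powr_powr)
    moreover have "v 0 = w 0" using v[of 0] b by simp
    moreover have "(b * z powr (1 / b)) powr b = b powr b * z" using b elim by (simp add: powr_mult powr_powr)
    ultimately show ?case using b elim by simp
  qed
  ultimately show ?thesis
    unfolding has_field_derivative_iff by (rule Lim_transform_eventually)
qed

theorem mainTheorem1:
  fixes s a :: real
  assumes "0 < s" and "s < 1" and "a = 1 - 2 * s"
  shows "\<exists>C>0. \<exists>C'>0. \<forall>(f :: real ^ 'n \<Rightarrow> real) u.
    smooth_fun f \<longrightarrow> bounded (range f) \<longrightarrow> is_extension a f u \<longrightarrow>
    (\<forall>x.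
      (\<exists>L M.
        ((\<lambda>y. y powr a * deriv (u x) y) \<longlongrightarrow> L) (at_right 0) \<and>
        ((\<lambda>y. (u x y - u x 0) / y powr (1 - a)) \<longlongrightarrow> M) (at_right 0) \<and>
        C * frac_laplacian s f x = - L \<and>
        - L = - (1 - a) * M) \<and>
      (\<forall>v :: real ^ 'n \<Rightarrow> real \<Rightarrow> real.
        (\<forall>x'. \<forall>y\<ge>0. v x' ((y / (1 - a)) powr (1 - a)) = u x' y) \<longrightarrow>
        (\<exists>D. (v x has_real_derivative D) (at_right 0) \<and>
             - D = C' * frac_laplacian s f x)))"
proof -
  let ?c = "poisson_const TYPE('n) a" and ?d = "frac_laplacian_const TYPE('n) s"
  have b: "1 - a > 0" using assms by simp
  have c: "?c > 0" using assms by (intro poisson_const_pos) auto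
  have d: "?d > 0" using assms by (intro frac_laplacian_const_pos)
  show ?thesis
  \<comment> \<open>Dividing by \<open>?d\<close> turns the principal value into the fractional
    Laplacian. The factor 1-a comes from differentiating y^(1-a), the factor (1-a)^(1-a) from the
    substitution for z.\<close>
  proof (rule exI[of _ "(1 - a) * ?c / ?d"], rule conjI[rotated],
      rule exI[of _ "(1 - a) powr (1 - a) * ?c / ?d"], rule conjI[rotated], intro allI impI conjI)
    fix f :: "real^'n \<Rightarrow> real" and u x
    assume f: "smooth_fun f" "bounded (range f)" "is_extension a f u"
    let ?M = "- ?c * pv_frac_integral s f x"
    note lim = extension_normal_derivative[OF assms f, of x]
    have eq: "(1 - a) * ?c / ?d * frac_laplacian s f x = - ((1 - a) * ?M)"
      using d by (simp add: frac_laplacian_def)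
    show "\<exists>L M. ((\<lambda>y. y powr a * deriv (u x) y) \<longlongrightarrow> L) (at_right 0) \<and>
        ((\<lambda>y. (u x y - u x 0) / y powr (1 - a)) \<longlongrightarrow> M) (at_right 0) \<and>
        (1 - a) * ?c / ?d * frac_laplacian s f x = - L \<and> - L = - (1 - a) * M"
    proof (rule exI[of _ "(1 - a) * ?M"], rule exI[of _ ?M], intro conjI)
      show "- ((1 - a) * ?M) = - (1 - a) * ?M" by (simp only: mult_minus_left)
    qed (rule lim eq)+
    fix v :: "real^'n \<Rightarrow> real \<Rightarrow> real"
    assume v: "\<forall>x'. \<forall>y\<ge>0. v x' ((y / (1 - a)) powr (1 - a)) = u x' y"
    have "(v x has_real_derivative (1 - a) powr (1 - a) * ?M) (at_right 0)"
      by (rule right_derivative_powr_substitution[OF b _ lim(1)]) (use v in blast)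
    moreover have "- ((1 - a) powr (1 - a) * ?M) = (1 - a) powr (1 - a) * ?c / ?d * frac_laplacian s f x"
      using d by (simp add: frac_laplacian_def)
    ultimately show "\<exists>D. (v x has_real_derivative D) (at_right 0) \<and>
             - D = (1 - a) powr (1 - a) * ?c / ?d * frac_laplacian s f x"
      by blast
  qed (use b c d in auto)
qed

end
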